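(* There is an absolute constant $C>0$ such that for all $\eta,\varepsilon,\delta\in(0,1/2]$ there exists an algorithm $\mathcal{A}$ (for the infinite-armed Bernoulli bandit described in the context, not knowing the reservoir distribution $\mu$) such that for every reservoir distribution $\mu$: (i) $\mathcal{A}$ is $(\eta,\varepsilon,\delta)$-PAC, i.e. its output arm $a_{i^*}$ satisfies $\mathbb{P}\big[p_{i^*}\ge G_\mu^{-1}(1-\eta)-\varepsilon\big]\ge 1-\delta$ (if the algorithm outputs no arm this counts as failure); and (ii) the expected number of samples $\mathbb{E}[T]$ used by $\mathcal{A}$ is at most $C\,\frac{\log(1/\delta)\log(1/\eta)}{\eta\varepsilon^2}$.
   Context: Infinite-armed Bernoulli bandit: a reservoir distribution $\mu$ is any Borel probability measure on $[0,1]$. There are countably many arms $a_1,a_2,\dots$ whose means $p_1,p_2,\dots$ are drawn i.i.d. from $\mu$ (unknown to the algorithm). Each time arm $a_i$ is sampled it returns a reward in $\{0,1\}$ distributed as Bernoulli$(p_i)$, independently of all other rewards given the means. An algorithm, at each time step, chooses (based on all previously observed rewards and possibly internal randomness) an arm to sample; at some (random) stopping time $T$ it stops and outputs an arm index $i^*$. Its sample complexity is $T$. Probabilities and expectations are over the means, the rewards and the algorithm's randomness. Write $G_\mu(\tau)=\mu([0,\tau])$ and $G_\mu^{-1}(p)=\inf\{\tau: G_\mu(\tau)\ge p\}$. *)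

theory Defs
  imports "HOL-Probability.Probability"
begin

text \<open>Infinite-armed Bernoulli bandit.
  Model: all randomness is generated up front.
  \<^item> means p :: nat \<Rightarrow> real, i.i.d. from the reservoir mu;
  \<^item> reward uniforms u :: nat \<times> nat \<Rightarrow> real, i.i.d. uniform on [0,1]; the k-th sample
    (k counted from 0) of arm i returns reward (u (i,k) < p i), i.e. Bernoulli(p i),
    independently of everything else given the means;
  \<^item> internal randomness s :: nat \<Rightarrow> real of the algorithm, i.i.d. uniform on [0,1].
  An algorithm maps its randomness and the history (list of (arm, reward)) to an
  action: sample an arm, or stop and output an arm.\<close>

datatype action = Sample nat | Stop nat

type_synonym history = "(nat \<times> bool) list"
type_synonym algorithm = "(nat \<Rightarrow> real) \<Rightarrow> history \<Rightarrow> action"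

definition unif01 :: "real measure" where
  "unif01 = uniform_measure lborel {0..1}"

definition seed_space :: "(nat \<Rightarrow> real) measure" where
  "seed_space = PiM UNIV (\<lambda>_. unif01)"

definition bandit_alg :: "algorithm \<Rightarrow> bool" where
  "bandit_alg A \<longleftrightarrow> (\<forall>h. (\<lambda>s. A s h) \<in> measurable seed_space (count_space UNIV))"

definition reservoir :: "real measure \<Rightarrow> bool" where
  "reservoir mu \<longleftrightarrow> prob_space mu \<and> sets mu = sets borel \<and> measure mu {0..1} = 1"

definition G :: "real measure \<Rightarrow> real \<Rightarrow> real" where
  "G mu \<tau> = measure mu {0..\<tau>}"

definition Ginv :: "real measure \<Rightarrow> real \<Rightarrow> real" where
  "Ginv mu q = Inf {\<tau>. G mu \<tau> \<ge> q}"

definition bandit_space :: "real measure \<Rightarrow> (((nat \<Rightarrow> real) \<times> (nat \<times> nat \<Rightarrow> real)) \<times> (nat \<Rightarrow> real)) measure" where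
  "bandit_space mu = (PiM UNIV (\<lambda>_::nat. mu) \<Otimes>\<^sub>M PiM UNIV (\<lambda>_::nat\<times>nat. unif01)) \<Otimes>\<^sub>M seed_space"

definition reward :: "(nat \<Rightarrow> real) \<Rightarrow> (nat \<times> nat \<Rightarrow> real) \<Rightarrow> history \<Rightarrow> nat \<Rightarrow> bool" where
  "reward p u h i = (u (i, length (filter (\<lambda>x. fst x = i) h)) < p i)"

primrec hist :: "algorithm \<Rightarrow> (nat \<Rightarrow> real) \<Rightarrow> (nat \<times> nat \<Rightarrow> real) \<Rightarrow> (nat \<Rightarrow> real) \<Rightarrow> nat \<Rightarrow> history" where
  "hist A p u s 0 = []"
| "hist A p u s (Suc n) = (case A s (hist A p u s n) of
       Sample i \<Rightarrow> hist A p u s n @ [(i, reward p u (hist A p u s n) i)]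
     | Stop i \<Rightarrow> hist A p u s n)"

definition stops_at :: "algorithm \<Rightarrow> (nat \<Rightarrow> real) \<Rightarrow> (nat \<times> nat \<Rightarrow> real) \<Rightarrow> (nat \<Rightarrow> real) \<Rightarrow> nat \<Rightarrow> bool" where
  "stops_at A p u s n \<longleftrightarrow> (\<exists>i. A s (hist A p u s n) = Stop i)"

definition stops :: "algorithm \<Rightarrow> (nat \<Rightarrow> real) \<Rightarrow> (nat \<times> nat \<Rightarrow> real) \<Rightarrow> (nat \<Rightarrow> real) \<Rightarrow> bool" where
  "stops A p u s \<longleftrightarrow> (\<exists>n. stops_at A p u s n)"

definition stop_time :: "algorithm \<Rightarrow> (nat \<Rightarrow> real) \<Rightarrow> (nat \<times> nat \<Rightarrow> real) \<Rightarrow> (nat \<Rightarrow> real) \<Rightarrow> nat" where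
  "stop_time A p u s = (LEAST n. stops_at A p u s n)"

definition sample_complexity :: "algorithm \<Rightarrow> (nat \<Rightarrow> real) \<Rightarrow> (nat \<times> nat \<Rightarrow> real) \<Rightarrow> (nat \<Rightarrow> real) \<Rightarrow> ennreal" where
  "sample_complexity A p u s = (if stops A p u s then of_nat (stop_time A p u s) else \<infinity>)"

definition out_arm :: "algorithm \<Rightarrow> (nat \<Rightarrow> real) \<Rightarrow> (nat \<times> nat \<Rightarrow> real) \<Rightarrow> (nat \<Rightarrow> real) \<Rightarrow> nat" where
  "out_arm A p u s = (case A s (hist A p u s (stop_time A p u s)) of Stop i \<Rightarrow> i | Sample i \<Rightarrow> i)"

definition success_event :: "algorithm \<Rightarrow> real measure \<Rightarrow> real \<Rightarrow> real \<Rightarrow> _ set" where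
  "success_event A mu \<eta> \<epsilon> = {\<omega> \<in> space (bandit_space mu).
      (case \<omega> of ((p, u), s) \<Rightarrow>
        stops A p u s \<and> p (out_arm A p u s) \<ge> Ginv mu (1 - \<eta>) - \<epsilon>)}"

definition expected_samples :: "algorithm \<Rightarrow> real measure \<Rightarrow> ennreal" where
  "expected_samples A mu = (\<integral>\<^sup>+ \<omega>. (case \<omega> of ((p, u), s) \<Rightarrow> sample_complexity A p u s) \<partial>bandit_space mu)"

end

theory Submission
  imports Defs
begin

text \<open>
  The algorithm works in two phases. Phase one samples each of \<open>M = O(log(1/\<delta>)/\<eta>)\<close> arms
  \<open>L = O(log(1/\<eta>)/\<epsilon>\<^sup>2)\<close> times; \<open>L\<close> is just large enough for an arm to be misjudged with
  probability below \<open>\<eta>/8\<close>, so by a Chernoff bound over the arms the \<open>\<eta>M/2\<close>-th largest estimate lies,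
  up to \<open>\<epsilon>/4\<close> and with probability \<open>1 - \<delta>/4\<close>, between \<open>Ginv (1 - \<eta>)\<close> and \<open>Ginv (1 - \<eta>/8)\<close>.
  Phase two tests fresh arms, each sampled \<open>K = O(log(M/\<delta>)/\<epsilon>\<^sup>2)\<close> times, and stops at the first
  whose estimate is at least this empirical quantile minus \<open>\<epsilon>/2\<close>. A union bound over the at most
  \<open>M\<close> fresh arms excludes a bad choice. A fresh arm is accepted with probability at least
  \<open>\<eta>/16\<close>, so the expected number of tests is \<open>O(1/\<eta>)\<close>; the cap \<open>M\<close> on the number of tests is paid
  only on an event of probability \<open>\<delta>/8\<close>, where \<open>M\<delta> = O(1/\<eta>)\<close>. Since
  \<open>log(1/\<delta>) + log(1/\<eta>) = O(log(1/\<delta>) log(1/\<eta>))\<close>, both phases meet the bound.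
\<close>

instance action :: countable by countable_datatype

section \<open>Independence of the arms\<close>

lemma prob_space_unif01: "prob_space unif01"
  unfolding unif01_def by (rule prob_space_uniform_measure) auto

lemma sets_unif01 [simp, measurable_cong]: "sets unif01 = sets borel"
  by (simp add: unif01_def)

lemma space_unif01 [simp]: "space unif01 = UNIV"
  by (simp add: unif01_def)

lemma unif01_lessThan:
  assumes "x \<in> {0..1}"
  shows "measure unif01 {..<x} = x"
proof -
  have "{0..1} \<inter> {..<x} = {0..<x}" using assms by auto
  then have "emeasure unif01 {..<x} = ennreal x"
    using assms by (simp add: unif01_def divide_ennreal_def)
  then show ?thesis using assms by (simp add: measure_def)
qed

lemma prob_space_seed_space: "prob_space seed_space"
  unfolding seed_space_def by (intro prob_space_PiM prob_space_unif01)

lemma space_seed_space [simp]: "space seed_space = UNIV"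
  by (simp add: seed_space_def space_PiM PiE_UNIV_domain)

lemma measurable_seed_space_component:
  "(\<lambda>w. w k) \<in> borel_measurable seed_space"
proof -
  have "(\<lambda>w. w k) \<in> measurable seed_space unif01"
    unfolding seed_space_def by measurable
  then show ?thesis by (simp cong: measurable_cong_sets)
qed

text \<open>The joint law of the coordinates is the product measure itself, whose marginals are the
  \<open>M i\<close>; this is the criterion for independence.\<close>

lemma indep_vars_PiM_component:
  assumes "\<And>i. i \<in> I \<Longrightarrow> prob_space (M i)" "I \<noteq> {}"
  shows "prob_space.indep_vars (Pi\<^sub>M I M) M (\<lambda>i \<omega>. \<omega> i) I"
proof -
  interpret prob_space "Pi\<^sub>M I M" by (intro prob_space_PiM assms)
  have "distr (Pi\<^sub>M I M) (Pi\<^sub>M I M) (\<lambda>x. restrict x I) = distr (Pi\<^sub>M I M) (Pi\<^sub>M I M) (\<lambda>x. x)"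
    by (intro distr_cong) (auto simp: space_PiM PiE_def extensional_restrict)
  also have "\<dots> = Pi\<^sub>M I M" by simp
  also have "\<dots> = (\<Pi>\<^sub>M i\<in>I. distr (Pi\<^sub>M I M) (M i) (\<lambda>x. x i))"
    by (intro PiM_cong refl) (auto simp: distr_PiM_component assms)
  finally show ?thesis
    by (subst indep_vars_iff_distr_eq_PiM') (auto simp: assms)
qed

lemma nn_integral_PiM_prod:
  assumes M: "\<And>i. prob_space (M i)" and J: "finite J"
    and f: "\<And>i. i \<in> J \<Longrightarrow> f i \<in> borel_measurable (M i)"
  shows "(\<integral>\<^sup>+\<omega>. (\<Prod>i\<in>J. f i (\<omega> i)) \<partial>Pi\<^sub>M UNIV M) = (\<Prod>i\<in>J. \<integral>\<^sup>+x. f i x \<partial>M i)"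
proof -
  interpret prob_space "Pi\<^sub>M UNIV M" by (intro prob_space_PiM M)
  have "indep_vars M (\<lambda>i \<omega>. \<omega> i) UNIV"
    by (rule indep_vars_PiM_component) (auto simp: M)
  then have "indep_vars M (\<lambda>i \<omega>. \<omega> i) J"
    by (rule indep_vars_subset) simp
  then have ind: "indep_vars (\<lambda>_. borel) (\<lambda>i \<omega>. f i (\<omega> i)) J"
    by (rule indep_vars_compose2) (rule f)
  have "(\<integral>\<^sup>+\<omega>. f i (\<omega> i) \<partial>Pi\<^sub>M UNIV M) = (\<integral>\<^sup>+x. f i x \<partial>M i)" if "i \<in> J" for i
    by (subst distr_PiM_component[of UNIV M i, symmetric])
       (auto simp: M nn_integral_distr f that)
  then show ?thesis
    by (subst indep_vars_nn_integral[OF J ind]) (auto intro!: prod.cong)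
qed

text \<open>Here \<open>seed_space\<close> serves as the space of an i.i.d. uniform sequence. A row
  of the reward table has this law because k \<mapsto> (i, k) is injective.\<close>

lemma distr_PiM_row:
  "distr (Pi\<^sub>M UNIV (\<lambda>_::nat\<times>nat. unif01)) seed_space (\<lambda>u k. u (i, k)) = seed_space"
proof -
  have "distr (Pi\<^sub>M UNIV (\<lambda>_::nat\<times>nat. unif01)) (\<Pi>\<^sub>M k\<in>UNIV. unif01) (\<lambda>u. \<lambda>k\<in>UNIV. u (i, k))
      = (\<Pi>\<^sub>M k\<in>UNIV. unif01)"
    by (rule distr_PiM_reindex) (auto simp: prob_space_unif01 inj_on_def)
  then show ?thesis by (simp add: seed_space_def restrict_UNIV)
qed

lemma measurable_row [measurable]:
  "(\<lambda>u k. u (i, k)) \<in> measurable (Pi\<^sub>M UNIV (\<lambda>_::nat\<times>nat. unif01)) seed_space"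
  unfolding seed_space_def by (rule measurable_PiM_single') (auto simp: PiE_UNIV_domain)

text \<open>Distinct rows use disjoint blocks \<open>{i} \<times> UNIV\<close> of independent
  coordinates.\<close>

lemma indep_vars_rows:
  "prob_space.indep_vars (Pi\<^sub>M UNIV (\<lambda>_::nat\<times>nat. unif01)) (\<lambda>_. seed_space) (\<lambda>i u k. u (i, k)) UNIV"
proof -
  let ?U = "Pi\<^sub>M UNIV (\<lambda>_::nat\<times>nat. unif01)"
  interpret prob_space ?U by (intro prob_space_PiM prob_space_unif01)
  have "indep_vars (\<lambda>_. unif01) (\<lambda>i \<omega>. \<omega> i) UNIV"
    by (rule indep_vars_PiM_component) (auto simp: prob_space_unif01)
  then have "indep_vars (\<lambda>i. Pi\<^sub>M ({i} \<times> UNIV) (\<lambda>_. unif01))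
     (\<lambda>i \<omega>. restrict (\<lambda>j. \<omega> j) ({i} \<times> UNIV)) UNIV"
    by (rule indep_vars_restrict) (auto simp: disjoint_family_on_def)
  then have "indep_vars (\<lambda>_. seed_space) (\<lambda>i \<omega>. (\<lambda>r k. r (i, k)) (restrict (\<lambda>j. \<omega> j) ({i} \<times> UNIV))) UNIV"
    by (rule indep_vars_compose2)
       (auto simp: seed_space_def PiE_UNIV_domain intro!: measurable_PiM_single' measurable_component_singleton)
  then show ?thesis by simp
qed

lemma nn_integral_rows_prod:
  assumes J: "finite J" and f: "\<And>i. i \<in> J \<Longrightarrow> f i \<in> borel_measurable seed_space"
  shows "(\<integral>\<^sup>+u. (\<Prod>i\<in>J. f i (\<lambda>k. u (i, k))) \<partial>Pi\<^sub>M UNIV (\<lambda>_::nat\<times>nat. unif01)) = (\<Prod>i\<in>J. \<integral>\<^sup>+w. f i w \<partial>seed_space)"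
proof -
  let ?U = "Pi\<^sub>M UNIV (\<lambda>_::nat\<times>nat. unif01)"
  interpret prob_space ?U by (intro prob_space_PiM prob_space_unif01)
  have "indep_vars (\<lambda>_. seed_space) (\<lambda>i u k. u (i, k)) J"
    by (rule indep_vars_subset[OF indep_vars_rows]) simp
  then have ind: "indep_vars (\<lambda>_. borel) (\<lambda>i u. f i (\<lambda>k. u (i, k))) J"
    by (rule indep_vars_compose2) (rule f)
  have "(\<integral>\<^sup>+u. f i (\<lambda>k. u (i, k)) \<partial>?U) = (\<integral>\<^sup>+w. f i w \<partial>seed_space)" if "i \<in> J" for i
    by (subst distr_PiM_row[of i, symmetric])
       (auto simp: nn_integral_distr f that)
  then show ?thesis
    by (subst indep_vars_nn_integral[OF J ind]) (auto intro!: prod.cong)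
qed

type_synonym outcome = "((nat \<Rightarrow> real) \<times> (nat \<times> nat \<Rightarrow> real)) \<times> (nat \<Rightarrow> real)"

text \<open>The mean is bundled with the row of reward uniforms so that the arms become i.i.d. and
  every statistic of an arm is a function of one of these variables.\<close>

definition arm :: "nat \<Rightarrow> outcome \<Rightarrow> real \<times> (nat \<Rightarrow> real)" where
  "arm i \<omega> = (fst (fst \<omega>) i, \<lambda>k. snd (fst \<omega>) (i, k))"

locale bandit =
  fixes mu :: "real measure"
  assumes res: "reservoir mu"
begin

sublocale mu: prob_space mu using res by (simp add: reservoir_def)

sublocale seed: prob_space seed_space by (rule prob_space_seed_space)

abbreviation "means_space \<equiv> Pi\<^sub>M UNIV (\<lambda>_::nat. mu)"
abbreviation "reward_space \<equiv> Pi\<^sub>M UNIV (\<lambda>_::nat\<times>nat. unif01)"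

sublocale means: prob_space means_space by (intro prob_space_PiM mu.prob_space_axioms)
sublocale rewards: prob_space reward_space by (intro prob_space_PiM prob_space_unif01)
sublocale pu: pair_prob_space means_space reward_space ..
sublocale armpair: pair_prob_space mu seed_space ..
sublocale pus: pair_prob_space "means_space \<Otimes>\<^sub>M reward_space" seed_space ..

sublocale prob_space "bandit_space mu"
  unfolding bandit_space_def by (rule pus.prob_space_axioms)

abbreviation "arm_space \<equiv> mu \<Otimes>\<^sub>M seed_space"

lemma sets_mu [simp, measurable_cong]: "sets mu = sets borel"
  using res by (simp add: reservoir_def)

lemma space_mu [simp]: "space mu = UNIV"
  using sets_eq_imp_space_eq[OF sets_mu] by simp

lemma AE_mu_unit_interval: "AE x in mu. x \<in> {0..1}"
  using res by (intro mu.AE_prob_1) (simp add: reservoir_def)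

lemma measurable_arm [measurable]: "arm i \<in> measurable (bandit_space mu) arm_space"
  unfolding arm_def bandit_space_def by measurable

text \<open>The seed integrates out; for fixed means the product factors over the rows, and what
  remains factors over the means. Singletons \<open>J\<close> give the law of an arm, indicators
  \<open>f\<close> give independence.\<close>

lemma nn_integral_arm_prod:
  assumes J: "finite J" and f: "\<And>i. i \<in> J \<Longrightarrow> f i \<in> borel_measurable arm_space"
  shows "(\<integral>\<^sup>+\<omega>. (\<Prod>i\<in>J. f i (arm i \<omega>)) \<partial>bandit_space mu) = (\<Prod>i\<in>J. \<integral>\<^sup>+z. f i z \<partial>arm_space)"
proof -
  note f[measurable]
  let ?g = "\<lambda>pu. \<Prod>i\<in>J. f i (fst pu i, \<lambda>k. snd pu (i, k))"
  have [measurable]: "?g \<in> borel_measurable (means_space \<Otimes>\<^sub>M reward_space)"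
    by measurable
  have "(\<integral>\<^sup>+\<omega>. (\<Prod>i\<in>J. f i (arm i \<omega>)) \<partial>bandit_space mu)
      = (\<integral>\<^sup>+pu. \<integral>\<^sup>+s. ?g pu \<partial>seed_space \<partial>(means_space \<Otimes>\<^sub>M reward_space))"
    unfolding bandit_space_def
    by (subst seed.nn_integral_fst[symmetric]) (auto simp: arm_def)
  also have "\<dots> = (\<integral>\<^sup>+pu. ?g pu \<partial>(means_space \<Otimes>\<^sub>M reward_space))"
    by (simp add: seed.emeasure_space_1[simplified])
  also have "\<dots> = (\<integral>\<^sup>+p. \<integral>\<^sup>+u. ?g (p, u) \<partial>reward_space \<partial>means_space)"
    by (subst rewards.nn_integral_fst[symmetric]) auto
  also have "\<dots> = (\<integral>\<^sup>+p. (\<Prod>i\<in>J. \<integral>\<^sup>+w. f i (p i, w) \<partial>seed_space) \<partial>means_space)"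
  proof (rule nn_integral_cong)
    fix p assume "p \<in> space means_space"
    have "(\<integral>\<^sup>+u. (\<Prod>i\<in>J. f i (p i, \<lambda>k. u (i, k))) \<partial>reward_space)
        = (\<Prod>i\<in>J. \<integral>\<^sup>+w. f i (p i, w) \<partial>seed_space)"
      by (rule nn_integral_rows_prod[where f = "\<lambda>i w. f i (p i, w)"]) (use J in auto)
    then show "(\<integral>\<^sup>+u. ?g (p, u) \<partial>reward_space) = (\<Prod>i\<in>J. \<integral>\<^sup>+w. f i (p i, w) \<partial>seed_space)"
      by simp
  qed
  also have "\<dots> = (\<Prod>i\<in>J. \<integral>\<^sup>+x. \<integral>\<^sup>+w. f i (x, w) \<partial>seed_space \<partial>mu)"
    by (rule nn_integral_PiM_prod[where f = "\<lambda>i x. \<integral>\<^sup>+w. f i (x, w) \<partial>seed_space"])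
       (use J mu.prob_space_axioms in auto)
  also have "\<dots> = (\<Prod>i\<in>J. \<integral>\<^sup>+z. f i z \<partial>arm_space)"
    by (intro prod.cong refl) (simp add: seed.nn_integral_fst)
  finally show ?thesis .
qed

lemma emeasure_arm:
  assumes [measurable]: "A \<in> sets arm_space"
  shows "emeasure (bandit_space mu) (arm i -` A \<inter> space (bandit_space mu)) = emeasure arm_space A"
proof -
  have "emeasure (bandit_space mu) (arm i -` A \<inter> space (bandit_space mu))
      = (\<integral>\<^sup>+\<omega>. indicator (arm i -` A \<inter> space (bandit_space mu)) \<omega> \<partial>bandit_space mu)"
    by (rule nn_integral_indicator[OF measurable_sets[OF measurable_arm assms], symmetric])
  also have "\<dots> = (\<integral>\<^sup>+\<omega>. indicator A (arm i \<omega>) \<partial>bandit_space mu)"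
    by (intro nn_integral_cong) (simp add: indicator_def)
  also have "\<dots> = emeasure arm_space A"
    using nn_integral_arm_prod[of "{i}" "\<lambda>_. indicator A"] assms
    by (simp add: nn_integral_indicator[OF assms])
  finally show ?thesis .
qed

lemma indep_vars_arm: "indep_vars (\<lambda>_. arm_space) arm UNIV"
proof -
  let ?\<Omega> = "bandit_space mu"
  have "prob (\<Inter>j\<in>J. A j) = (\<Prod>j\<in>J. prob (A j))"
    if J: "J \<noteq> {}" "finite J" and A: "\<forall>j\<in>J. A j \<in> {arm j -` B \<inter> space ?\<Omega> |B. B \<in> sets arm_space}" for J A
  proof -
    have "\<forall>j\<in>J. \<exists>B. A j = arm j -` B \<inter> space ?\<Omega> \<and> B \<in> sets arm_space"
      using A by blast
    then obtain B where B: "\<And>j. j \<in> J \<Longrightarrow> A j = arm j -` B j \<inter> space ?\<Omega>"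
        "\<And>j. j \<in> J \<Longrightarrow> B j \<in> sets arm_space"
      by metis
    have Am: "A j \<in> events" if "j \<in> J" for j
      using B[OF that] measurable_sets[OF measurable_arm] by auto
    then have Im: "(\<Inter>j\<in>J. A j) \<in> events"
      using J by (intro sets.finite_INT) auto
    have "emeasure ?\<Omega> (\<Inter>j\<in>J. A j) = (\<integral>\<^sup>+\<omega>. (\<Prod>j\<in>J. indicator (B j) (arm j \<omega>)) \<partial>?\<Omega>)"
      unfolding nn_integral_indicator[OF Im, symmetric]
    proof (rule nn_integral_cong)
      fix \<omega> assume \<omega>: "\<omega> \<in> space ?\<Omega>"
      show "indicator (\<Inter>j\<in>J. A j) \<omega> = (\<Prod>j\<in>J. indicator (B j) (arm j \<omega>) :: ennreal)"
      proof (cases "\<omega> \<in> (\<Inter>j\<in>J. A j)")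
        case True
        then have "\<And>j. j \<in> J \<Longrightarrow> arm j \<omega> \<in> B j" using B(1) by blast
        then show ?thesis using True by simp
      next
        case False
        then obtain j where j: "j \<in> J" "arm j \<omega> \<notin> B j" using B(1) \<omega> by blast
        then have "(\<Prod>j\<in>J. indicator (B j) (arm j \<omega>) :: ennreal) = 0"
          using J by (intro prod_zero) (auto intro!: bexI[of _ j])
        then show ?thesis using False by simp
      qed
    qed
    also have "\<dots> = (\<Prod>j\<in>J. emeasure arm_space (B j))"
      using J B by (subst nn_integral_arm_prod) auto
    also have "\<dots> = (\<Prod>j\<in>J. emeasure ?\<Omega> (A j))"
      by (intro prod.cong refl) (simp add: B(1) emeasure_arm[OF B(2)])
    finally show ?thesis
      by (simp add: emeasure_eq_measure prod_ennreal prod_nonneg)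
  qed
  then have "indep_sets (\<lambda>i. {arm i -` B \<inter> space ?\<Omega> |B. B \<in> sets arm_space}) UNIV"
    using measurable_sets[OF measurable_arm]
    by (intro indep_setsI) (blast, auto)
  then show ?thesis
    unfolding indep_vars_def2 using measurable_arm by blast
qed

end

section \<open>Concentration inequalities\<close>

context prob_space
begin

text \<open>Generating function of the number of events that occur. The bases 2 and 1/2 give the two
  Chernoff bounds, base 0 the probability that no event occurs.\<close>

lemma expectation_power_card:
  fixes B :: "'i \<Rightarrow> 'a \<Rightarrow> bool" and c :: real
  assumes ind: "indep_vars (\<lambda>_. count_space UNIV) B I" and I: "finite I"
  shows "integrable M (\<lambda>\<omega>. c ^ card {i\<in>I. B i \<omega>})"
    and "expectation (\<lambda>\<omega>. c ^ card {i\<in>I. B i \<omega>}) = (\<Prod>i\<in>I. 1 + (c - 1) * prob {\<omega>\<in>space M. B i \<omega>})"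
proof -
  let ?f = "\<lambda>b. if b then c else 1"
  have B: "B i \<in> measurable M (count_space UNIV)" if "i \<in> I" for i
    using ind that by (simp add: indep_vars_def)
  have ind': "indep_vars (\<lambda>_. borel) (\<lambda>i \<omega>. ?f (B i \<omega>)) I"
    by (rule indep_vars_compose2[OF ind]) simp
  have int: "integrable M (\<lambda>\<omega>. ?f (B i \<omega>))" if "i \<in> I" for i
  proof (rule integrable_const_bound[where B = "\<bar>c\<bar> + 1"])
    show "(\<lambda>\<omega>. ?f (B i \<omega>)) \<in> borel_measurable M"
      using ind' that by (simp add: indep_vars_def)
  qed auto
  have E: "expectation (\<lambda>\<omega>. ?f (B i \<omega>)) = 1 + (c - 1) * prob {\<omega>\<in>space M. B i \<omega>}" if "i \<in> I" for i
  proof -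
    note B[OF that, measurable]
    have "expectation (\<lambda>\<omega>. ?f (B i \<omega>)) = expectation (\<lambda>\<omega>. 1 + (c - 1) * indicator {\<omega>\<in>space M. B i \<omega>} \<omega>)"
      by (intro Bochner_Integration.integral_cong) auto
    also have "\<dots> = 1 + (c - 1) * prob {\<omega>\<in>space M. B i \<omega>}"
      by (subst Bochner_Integration.integral_add) (auto simp: prob_space emeasure_eq_measure)
    finally show ?thesis .
  qed
  have eq: "c ^ card {i\<in>I. B i \<omega>} = (\<Prod>i\<in>I. ?f (B i \<omega>))" for \<omega>
    using I by (simp add: prod.If_cases Int_def)
  show "integrable M (\<lambda>\<omega>. c ^ card {i\<in>I. B i \<omega>})"
    unfolding eq by (rule indep_vars_integrable[OF I ind' int])
  show "expectation (\<lambda>\<omega>. c ^ card {i\<in>I. B i \<omega>}) = (\<Prod>i\<in>I. 1 + (c - 1) * prob {\<omega>\<in>space M. B i \<omega>})"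
    unfolding eq by (subst indep_vars_lebesgue_integral[OF I ind' int]) (auto simp: E)
qed

text \<open>Markov's inequality for 2 to the count, then 1 + x \<le> exp x in each factor. A fixed
  base suffices because the later thresholds are a constant factor away from the mean.\<close>

lemma prob_card_ge_le:
  fixes B :: "'i \<Rightarrow> 'a \<Rightarrow> bool"
  assumes ind: "indep_vars (\<lambda>_. count_space UNIV) B I" and I: "finite I"
    and r: "\<And>i. i \<in> I \<Longrightarrow> prob {\<omega>\<in>space M. B i \<omega>} \<le> r"
  shows "prob {\<omega>\<in>space M. real (card {i\<in>I. B i \<omega>}) \<ge> \<kappa>} \<le> exp (r * card I - \<kappa> * ln 2)"
proof -
  have "{\<omega>\<in>space M. real (card {i\<in>I. B i \<omega>}) \<ge> \<kappa>}
      = {\<omega>\<in>space M. (2::real) ^ card {i\<in>I. B i \<omega>} \<ge> exp (\<kappa> * ln 2)}"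
  proof -
    have "exp (\<kappa> * ln 2) \<le> (2::real) ^ n \<longleftrightarrow> \<kappa> \<le> real n" for n
    proof -
      have "(2::real) ^ n = exp (real n * ln 2)" by (simp add: exp_of_nat_mult)
      then show ?thesis by simp
    qed
    then show ?thesis by simp
  qed
  also have "prob \<dots> \<le> expectation (\<lambda>\<omega>. 2 ^ card {i\<in>I. B i \<omega>}) / exp (\<kappa> * ln 2)"
    by (rule integral_Markov_inequality_measure[where A = "{}"])
       (use expectation_power_card(1)[OF ind I, of 2] in auto)
  also have "expectation (\<lambda>\<omega>. 2 ^ card {i\<in>I. B i \<omega>}) = (\<Prod>i\<in>I. 1 + prob {\<omega>\<in>space M. B i \<omega>})"
    using expectation_power_card(2)[OF ind I, of 2] by simp
  also have "\<dots> \<le> (\<Prod>i\<in>I. exp r)"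
  proof (rule prod_mono)
    fix i assume "i \<in> I"
    have "1 + prob {\<omega>\<in>space M. B i \<omega>} \<le> exp (prob {\<omega>\<in>space M. B i \<omega>})"
      by (rule exp_ge_add_one_self)
    also have "\<dots> \<le> exp r" using r[OF \<open>i \<in> I\<close>] by simp
    finally show "0 \<le> 1 + prob {\<omega>\<in>space M. B i \<omega>} \<and> 1 + prob {\<omega>\<in>space M. B i \<omega>} \<le> exp r"
      by (simp add: add_nonneg_nonneg)
  qed
  also have "(\<Prod>i\<in>I. exp r) / exp (\<kappa> * ln 2) = exp (r * card I - \<kappa> * ln 2)"
    using exp_of_nat2_mult[of r "card I"] by (simp add: exp_diff)
  finally show ?thesis by (simp add: divide_right_mono)
qed

text \<open>Base 1/2 turns small counts into large values, so that Markov's inequality applies to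
  the lower tail.\<close>

lemma prob_card_less_le:
  fixes B :: "'i \<Rightarrow> 'a \<Rightarrow> bool"
  assumes ind: "indep_vars (\<lambda>_. count_space UNIV) B I" and I: "finite I"
    and r: "\<And>i. i \<in> I \<Longrightarrow> prob {\<omega>\<in>space M. B i \<omega>} \<ge> r"
  shows "prob {\<omega>\<in>space M. real (card {i\<in>I. B i \<omega>}) \<le> \<kappa>} \<le> exp (\<kappa> * ln 2 - r * card I / 2)"
proof -
  have "{\<omega>\<in>space M. real (card {i\<in>I. B i \<omega>}) \<le> \<kappa>}
      = {\<omega>\<in>space M. (1/2::real) ^ card {i\<in>I. B i \<omega>} \<ge> exp (- \<kappa> * ln 2)}"
  proof -
    have "exp (- \<kappa> * ln 2) \<le> (1/2::real) ^ n \<longleftrightarrow> real n \<le> \<kappa>" for n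
    proof -
      have "(1/2::real) ^ n = exp (- real n * ln 2)" by (simp add: exp_minus exp_of_nat_mult field_simps)
      then show ?thesis by simp
    qed
    then show ?thesis by simp
  qed
  also have "prob \<dots> \<le> expectation (\<lambda>\<omega>. (1/2) ^ card {i\<in>I. B i \<omega>}) / exp (- \<kappa> * ln 2)"
    by (rule integral_Markov_inequality_measure[where A = "{}"])
       (use expectation_power_card(1)[OF ind I, of "1/2"] in auto)
  also have "expectation (\<lambda>\<omega>. (1/2) ^ card {i\<in>I. B i \<omega>}) = (\<Prod>i\<in>I. 1 - prob {\<omega>\<in>space M. B i \<omega>} / 2)"
    using expectation_power_card(2)[OF ind I, of "1/2"] by simp
  also have "\<dots> \<le> (\<Prod>i\<in>I. exp (- r / 2))"
  proof (rule prod_mono)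
    fix i assume "i \<in> I"
    have "1 + - prob {\<omega>\<in>space M. B i \<omega>} / 2 \<le> exp (- prob {\<omega>\<in>space M. B i \<omega>} / 2)"
      by (rule exp_ge_add_one_self)
    also have "\<dots> \<le> exp (- r / 2)" using r[OF \<open>i \<in> I\<close>] by simp
    finally show "0 \<le> 1 - prob {\<omega>\<in>space M. B i \<omega>} / 2 \<and> 1 - prob {\<omega>\<in>space M. B i \<omega>} / 2 \<le> exp (- r / 2)"
      using order_trans[OF prob_le_1[of "{\<omega>\<in>space M. B i \<omega>}"], of 2] by simp
  qed
  also have "(\<Prod>i\<in>I. exp (- r / 2)) / exp (- \<kappa> * ln 2) = exp (\<kappa> * ln 2 - r * card I / 2)"
    using exp_of_nat2_mult[of "- r / 2" "card I"] exp_diff[of "- r / 2 * card I" "- \<kappa> * ln 2"]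
    by (simp add: algebra_simps)
  finally show ?thesis by (simp add: divide_right_mono)
qed

text \<open>Base 0 of the generating function, since \<open>0 ^ n\<close> is the indicator of n =
  0.\<close>

lemma prob_none:
  fixes B :: "'i \<Rightarrow> 'a \<Rightarrow> bool"
  assumes ind: "indep_vars (\<lambda>_. count_space UNIV) B I" and I: "finite I"
  shows "prob {\<omega>\<in>space M. \<forall>i\<in>I. \<not> B i \<omega>} = (\<Prod>i\<in>I. 1 - prob {\<omega>\<in>space M. B i \<omega>})"
proof -
  have *: "(0::real) ^ card {i\<in>I. B i \<omega>} = of_bool (\<forall>i\<in>I. \<not> B i \<omega>)" for \<omega>
    using I by (auto simp: power_0_left card_eq_0_iff)
  have "expectation (\<lambda>\<omega>. (0::real) ^ card {i\<in>I. B i \<omega>}) = expectation (indicator {\<omega>\<in>space M. \<forall>i\<in>I. \<not> B i \<omega>})"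
    by (intro Bochner_Integration.integral_cong) (auto simp: * indicator_def)
  also have "\<dots> = prob {\<omega>\<in>space M. \<forall>i\<in>I. \<not> B i \<omega>}"
    by (simp add: Int_absorb2)
  finally show ?thesis
    using expectation_power_card(2)[OF ind I, of 0] by simp
qed

end

section \<open>Hoeffding bounds for the empirical mean of one arm\<close>

definition successes :: "nat \<Rightarrow> real \<times> (nat \<Rightarrow> real) \<Rightarrow> nat" where
  "successes n z = card {k\<in>{..<n}. snd z k < fst z}"

text \<open>For a fixed mean \<open>x\<close> the rewards are i.i.d. indicators of
  \<open>w k < x\<close>, with expectation \<open>x\<close> because \<open>x\<close> lies in [0,1];
  Hoeffding's inequality applies.\<close>

lemma successes_tail:
  assumes x: "x \<in> {0..1}" and n: "0 < n" and a: "0 \<le> a"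
  shows "measure seed_space {w. real (successes n (x, w)) / n \<ge> x + a} \<le> exp (- 2 * real n * a\<^sup>2)"
    and "measure seed_space {w. real (successes n (x, w)) / n \<le> x - a} \<le> exp (- 2 * real n * a\<^sup>2)"
proof -
  interpret prob_space seed_space by (rule prob_space_seed_space)
  define X where "X k w = (indicator {..<x} (w k) :: real)" for k :: nat and w :: "nat \<Rightarrow> real"
  have ind: "indep_vars (\<lambda>_. borel) X {..<n}"
  proof -
    have "indep_vars (\<lambda>_. unif01) (\<lambda>k w. w k) UNIV"
      unfolding seed_space_def by (rule indep_vars_PiM_component) (auto simp: prob_space_unif01)
    then have "indep_vars (\<lambda>_. unif01) (\<lambda>k w. w k) {..<n}"
      by (rule indep_vars_subset) simp
    then show ?thesis
      unfolding X_def
      by (rule indep_vars_compose2[where X = "\<lambda>k w. w k" and M' = "\<lambda>_. unif01" and Y = "\<lambda>_. indicator {..<x}"])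
         (auto intro!: borel_measurable_indicator)
  qed
  have [measurable]: "X k \<in> borel_measurable seed_space" for k
    unfolding X_def using measurable_seed_space_component[measurable] by measurable
  have comp: "distr seed_space unif01 (\<lambda>w. w k) = unif01" for k
    unfolding seed_space_def by (rule distr_PiM_component) (auto simp: prob_space_unif01)
  have [measurable]: "(\<lambda>w. w k) \<in> measurable seed_space unif01" for k
    unfolding seed_space_def by measurable
  have dX: "distr seed_space borel (X k) = distr unif01 borel (indicator {..<x})" for k
  proof -
    have "distr seed_space borel (X k) = distr (distr seed_space unif01 (\<lambda>w. w k)) borel (indicator {..<x})"
      by (subst distr_distr) (auto simp: X_def[abs_def] comp_def intro!: borel_measurable_indicator)
    then show ?thesis by (simp add: comp)
  qed
  have EX: "expectation (X 0) = x"
  proof -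
    have "expectation (X 0) = (\<integral>w. indicator {..<x} w \<partial>distr seed_space unif01 (\<lambda>w. w 0))"
      by (subst integral_distr) (auto simp: X_def[abs_def] intro!: borel_measurable_indicator)
    also have "\<dots> = x" using x by (simp add: comp unif01_lessThan)
    finally show ?thesis .
  qed
  interpret H: Hoeffding_ineq_iid seed_space "{..<n}" X "X 0" 0 1 x
    by unfold_locales (auto simp: ind dX EX X_def)
  have sum: "(\<Sum>k<n. X k w) = real (successes n (x, w))" for w
  proof -
    have "(\<Sum>k<n. X k w) = (\<Sum>k\<in>{k\<in>{..<n}. w k < x}. 1)"
      by (intro sum.mono_neutral_cong_right) (auto simp: X_def)
    then show ?thesis by (simp add: successes_def)
  qed
  have I: "{..<n} \<noteq> {}" using n by auto
  show "measure seed_space {w. real (successes n (x, w)) / n \<ge> x + a} \<le> exp (- 2 * real n * a\<^sup>2)"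
    using H.Hoeffding_ineq_ge'[OF a _ I] by (simp add: sum)
  show "measure seed_space {w. real (successes n (x, w)) / n \<le> x - a} \<le> exp (- 2 * real n * a\<^sup>2)"
    using H.Hoeffding_ineq_le'[OF a _ I] by (simp add: sum)
qed
section \<open>Estimates for a single arm, quantiles and measurability\<close>

context bandit
begin

lemma measurable_successes [measurable]: "successes n \<in> measurable arm_space (count_space UNIV)"
proof -
  have "(\<lambda>z. card {k. k < n \<and> snd z k < fst z}) \<in> measurable arm_space (count_space UNIV)"
    using measurable_seed_space_component[measurable] by (intro measurable_card) measurable
  also have "(\<lambda>z. card {k. k < n \<and> snd z k < fst z}) = successes n"
    by (simp add: fun_eq_iff successes_def)
  finally show ?thesis .
qed

text \<open>By Fubini the mean x may be fixed. For x \<le> c an estimate of at least c + a is at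
  least x + a, so Hoeffding applies; for x > c the fibre is empty.\<close>

lemma prob_overestimate_le:
  assumes n: "0 < n" and a: "0 \<le> a"
  shows "measure arm_space {z\<in>space arm_space. fst z \<le> c \<and> real (successes n z) / n \<ge> c + a}
       \<le> exp (- 2 * real n * a\<^sup>2)"
proof -
  let ?A = "{z\<in>space arm_space. fst z \<le> c \<and> real (successes n z) / n \<ge> c + a}"
  have [measurable]: "?A \<in> sets arm_space" by measurable
  have "emeasure arm_space ?A = (\<integral>\<^sup>+x. emeasure seed_space (Pair x -` ?A) \<partial>mu)"
    by (rule seed.emeasure_pair_measure_alt) measurable
  also have "\<dots> \<le> (\<integral>\<^sup>+x. ennreal (exp (- 2 * real n * a\<^sup>2)) \<partial>mu)"
  proof (rule nn_integral_mono_AE, use AE_mu_unit_interval in eventually_elim)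
    fix x :: real assume x: "x \<in> {0..1}"
    show "emeasure seed_space (Pair x -` ?A) \<le> ennreal (exp (- 2 * real n * a\<^sup>2))"
    proof (cases "x \<le> c")
      case True
      have "emeasure seed_space (Pair x -` ?A) \<le> emeasure seed_space {w\<in>space seed_space. real (successes n (x, w)) / n \<ge> x + a}"
      proof (rule emeasure_mono)
        have [measurable]: "(\<lambda>w. successes n (x, w)) \<in> measurable seed_space (count_space UNIV)"
          by measurable
        show "{w\<in>space seed_space. real (successes n (x, w)) / n \<ge> x + a} \<in> sets seed_space"
          by measurable
      qed (use True in auto)
      also have "\<dots> \<le> ennreal (exp (- 2 * real n * a\<^sup>2))"
        using successes_tail(1)[OF x n a] by (simp add: seed.emeasure_eq_measure)
      finally show ?thesis .
    qed auto
  qed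
  also have "\<dots> = ennreal (exp (- 2 * real n * a\<^sup>2))"
    using mu.emeasure_space_1 by simp
  finally show ?thesis by (simp add: armpair.emeasure_eq_measure)
qed

text \<open>An estimate above c + a requires a mean above c or an overestimate of a mean at most c;
  the two probabilities are added.\<close>

lemma prob_estimate_gt_le:
  assumes n: "0 < n" and a: "0 \<le> a"
  shows "measure arm_space {z\<in>space arm_space. real (successes n z) / n > c + a}
       \<le> measure mu {c<..} + exp (- 2 * real n * a\<^sup>2)"
proof -
  let ?A = "{z\<in>space arm_space. fst z \<le> c \<and> real (successes n z) / n \<ge> c + a}"
  have C: "{c<..} \<times> UNIV \<in> sets arm_space"
    using pair_measureI[of "{c<..}" mu "space seed_space" seed_space, OF _ sets.top] by simp
  have A: "?A \<in> sets arm_space" by measurable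
  have "measure arm_space {z\<in>space arm_space. real (successes n z) / n > c + a}
     \<le> measure arm_space ({c<..} \<times> UNIV \<union> ?A)"
    by (rule armpair.finite_measure_mono[OF _ sets.Un[OF C A]]) (auto simp: space_pair_measure)
  also have "\<dots> \<le> measure arm_space ({c<..} \<times> UNIV) + measure arm_space ?A"
    by (rule measure_Un_le[OF C A])
  also have "measure arm_space ({c<..} \<times> UNIV) = measure mu {c<..}"
    using seed.emeasure_pair_measure_Times[of "{c<..}" mu "space seed_space"] seed.emeasure_space_1
      sets.top[of seed_space]
    by (simp add: measure_def)
  also have "measure arm_space ?A \<le> exp (- 2 * real n * a\<^sup>2)"
    by (rule prob_overestimate_le[OF n a])
  finally show ?thesis by simp
qed

text \<open>Conditioning on the mean gives a product, where a union bound would give a difference;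
  the result stays a constant fraction of \<open>measure mu {c..}\<close> even when that mass is
  tiny.\<close>

lemma prob_good_estimate_ge:
  assumes n: "0 < n" and a: "0 \<le> a"
  shows "measure arm_space {z\<in>space arm_space. real (successes n z) / n \<ge> c - a}
       \<ge> measure mu {c..} * (1 - exp (- 2 * real n * a\<^sup>2))"
proof -
  let ?A = "{z\<in>space arm_space. real (successes n z) / n \<ge> c - a}"
  let ?e = "exp (- 2 * real n * a\<^sup>2)"
  have e: "?e \<le> 1" using a by simp
  have [measurable]: "?A \<in> sets arm_space" by measurable
  have "ennreal (measure mu {c..} * (1 - ?e)) = (\<integral>\<^sup>+x. ennreal (1 - ?e) * indicator {c..} x \<partial>mu)"
    using e by (subst nn_integral_cmult_indicator) (auto simp: mu.emeasure_eq_measure ennreal_mult mult.commute)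
  also have "\<dots> \<le> (\<integral>\<^sup>+x. emeasure seed_space (Pair x -` ?A) \<partial>mu)"
  proof (rule nn_integral_mono_AE, use AE_mu_unit_interval in eventually_elim)
    fix x :: real assume x: "x \<in> {0..1}"
    show "ennreal (1 - ?e) * indicator {c..} x \<le> emeasure seed_space (Pair x -` ?A)"
    proof (cases "c \<le> x")
      case True
      have [measurable]: "(\<lambda>w. successes n (x, w)) \<in> measurable seed_space (count_space UNIV)"
        by measurable
      let ?D = "{w\<in>space seed_space. real (successes n (x, w)) / n \<le> x - a}"
      have "1 - ?e \<le> 1 - measure seed_space ?D"
        using successes_tail(2)[OF x n a] by simp
      also have "\<dots> = measure seed_space (space seed_space - ?D)"
        by (rule seed.prob_compl[symmetric]) measurable
      also have "\<dots> \<le> measure seed_space (Pair x -` ?A)"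
        by (rule seed.finite_measure_mono[OF _ sets_Pair1])
           (use True \<open>?A \<in> sets arm_space\<close> in \<open>auto simp: space_pair_measure\<close>)
      finally show ?thesis using True by (simp add: seed.emeasure_eq_measure)
    qed auto
  qed
  also have "\<dots> = emeasure arm_space ?A"
    by (rule seed.emeasure_pair_measure_alt[symmetric]) measurable
  finally show ?thesis by (simp add: armpair.emeasure_eq_measure)
qed

section \<open>Quantiles of the reservoir\<close>

sublocale mu: real_distribution mu
  by unfold_locales simp

text \<open>\<open>mu\<close> is carried by [0,1], so starting the interval at 0 loses no mass. The
  one-sided limits of \<open>cdf\<close> thus become available.\<close>

lemma G_eq_cdf: "G mu t = cdf mu t"
  unfolding G_def cdf_def
  using AE_mu_unit_interval by (intro mu.finite_measure_eq_AE) auto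

context
  fixes r :: real
  assumes r: "0 < r" "r < 1"
begin

lemma cdf_less_if_less_Ginv: "t < Ginv mu r \<Longrightarrow> cdf mu t < r"
proof (rule ccontr)
  assume t: "t < Ginv mu r" and "\<not> cdf mu t < r"
  then have "t \<in> {t. G mu t \<ge> r}" by (simp add: G_eq_cdf)
  \<comment> \<open>0 is a lower bound: for negative t the interval in \<open>G\<close> is empty,
    while r > 0.\<close>
  moreover have "bdd_below {t. G mu t \<ge> r}"
    by (rule bdd_belowI[of _ 0]) (use r in \<open>auto simp: G_def not_le[symmetric] intro: ccontr\<close>)
  ultimately show False using t unfolding Ginv_def by (meson cInf_lower not_le)
qed

lemma cdf_ge_if_Ginv_less: "Ginv mu r < t \<Longrightarrow> r \<le> cdf mu t"
proof -
  assume t: "Ginv mu r < t"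
  have "G mu 1 = 1" using res by (simp add: G_def reservoir_def)
  then have "{t. G mu t \<ge> r} \<noteq> {}" using r by (auto intro!: exI[of _ 1])
  then obtain s where "s < t" "G mu s \<ge> r"
    using cInf_lessD[of "{t. G mu t \<ge> r}" t] t unfolding Ginv_def by blast
  then show ?thesis using mu.cdf_nondecreasing[of s t] by (simp add: G_eq_cdf)
qed

text \<open>The left limit of the cdf is the mass strictly below the point, and left of the quantile
  the cdf is below r. An atom at the quantile thus counts for the upper half-line.\<close>

lemma measure_atLeast_Ginv: "measure mu {Ginv mu r..} \<ge> 1 - r"
proof -
  have "measure mu {..<Ginv mu r} \<le> r"
    by (rule tendsto_upperbound[OF mu.cdf_at_left])
       (auto simp: eventually_at_filter cdf_less_if_less_Ginv less_imp_le)
  moreover have "measure mu {Ginv mu r..} = 1 - measure mu {..<Ginv mu r}"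
    using mu.prob_compl[of "{..<Ginv mu r}"] by (simp add: Compl_eq_Diff_UNIV[symmetric])
  ultimately show ?thesis by simp
qed

text \<open>Right continuity carries \<open>r \<le> cdf mu t\<close> from points above the quantile
  to the quantile itself.\<close>

lemma measure_greaterThan_Ginv: "measure mu {Ginv mu r<..} \<le> 1 - r"
proof -
  have "(cdf mu \<longlongrightarrow> cdf mu (Ginv mu r)) (at_right (Ginv mu r))"
    using mu.cdf_is_right_cont by (simp add: continuous_within)
  then have "r \<le> cdf mu (Ginv mu r)"
    by (rule tendsto_lowerbound) (auto simp: eventually_at_filter cdf_ge_if_Ginv_less)
  moreover have "measure mu {Ginv mu r<..} = 1 - cdf mu (Ginv mu r)"
    using mu.prob_compl[of "{..Ginv mu r}"] by (simp add: cdf_def Compl_eq_Diff_UNIV[symmetric])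
  ultimately show ?thesis by simp
qed

end

section \<open>Measurability of a run and of the success event\<close>

lemma measurable_mean [measurable]: "(\<lambda>\<omega>. fst (fst \<omega>) i) \<in> borel_measurable (bandit_space mu)"
  unfolding bandit_space_def by measurable

text \<open>Histories and actions range over countable types, so one step is proved measurable for a
  fixed history and a fixed action, and the pieces are glued.\<close>

lemma measurable_hist:
  assumes "bandit_alg A"
  shows "(\<lambda>\<omega>. hist A (fst (fst \<omega>)) (snd (fst \<omega>)) (snd \<omega>) n) \<in> measurable (bandit_space mu) (count_space UNIV)"
proof (induction n)
  case (Suc n)
  have act [measurable]: "(\<lambda>\<omega>. A (snd \<omega>) h) \<in> measurable (bandit_space mu) (count_space UNIV)" for h
    using assms unfolding bandit_alg_def bandit_space_def by (intro measurable_compose[OF measurable_snd]) auto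
  have rew [measurable]: "Measurable.pred (bandit_space mu) (\<lambda>\<omega>. reward (fst (fst \<omega>)) (snd (fst \<omega>)) h i)" for h i
    unfolding reward_def bandit_space_def by measurable
  have step: "(\<lambda>\<omega>. case A (snd \<omega>) h of
       Sample i \<Rightarrow> h @ [(i, reward (fst (fst \<omega>)) (snd (fst \<omega>)) h i)] | Stop i \<Rightarrow> h)
     \<in> measurable (bandit_space mu) (count_space UNIV)" for h
  proof (rule measurable_compose_countable[OF _ act])
    fix a
    show "(\<lambda>\<omega>. case a of Sample i \<Rightarrow> h @ [(i, reward (fst (fst \<omega>)) (snd (fst \<omega>)) h i)] | Stop i \<Rightarrow> h)
        \<in> measurable (bandit_space mu) (count_space UNIV)"
    proof (cases a)
      case (Sample i)
      have "(\<lambda>\<omega>. (\<lambda>b. h @ [(i, b)]) (reward (fst (fst \<omega>)) (snd (fst \<omega>)) h i))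
          \<in> measurable (bandit_space mu) (count_space UNIV)"
        by (rule measurable_compose[OF rew]) simp
      then show ?thesis by (simp add: Sample)
    qed simp
  qed
  show ?case
    using measurable_compose_countable[OF step Suc] by simp
qed simp

lemma measurable_action:
  assumes "bandit_alg A"
  shows "(\<lambda>\<omega>. A (snd \<omega>) (hist A (fst (fst \<omega>)) (snd (fst \<omega>)) (snd \<omega>) n)) \<in> measurable (bandit_space mu) (count_space UNIV)"
proof (rule measurable_compose_countable[OF _ measurable_hist[OF assms]])
  show "(\<lambda>\<omega>. A (snd \<omega>) h) \<in> measurable (bandit_space mu) (count_space UNIV)" for h
    using assms unfolding bandit_alg_def bandit_space_def by (intro measurable_compose[OF measurable_snd]) auto
qed

text \<open>Needed to bound the probability of this event from below by that of a subset.\<close>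

lemma success_event_measurable:
  assumes "bandit_alg A"
  shows "success_event A mu \<eta> \<epsilon> \<in> events"
proof -
  let ?p = "\<lambda>\<omega>::outcome. fst (fst \<omega>)" and ?u = "\<lambda>\<omega>::outcome. snd (fst \<omega>)"
  have sa [measurable]: "Measurable.pred (bandit_space mu) (\<lambda>\<omega>. stops_at A (?p \<omega>) (?u \<omega>) (snd \<omega>) n)" for n
    unfolding stops_at_def
    by (rule measurable_compose[OF measurable_action[OF assms], where g = "\<lambda>a. \<exists>i. a = Stop i"]) simp
  have st: "(\<lambda>\<omega>. stop_time A (?p \<omega>) (?u \<omega>) (snd \<omega>)) \<in> measurable (bandit_space mu) (count_space UNIV)"
    unfolding stop_time_def by measurable
  have oa: "(\<lambda>\<omega>. out_arm A (?p \<omega>) (?u \<omega>) (snd \<omega>)) \<in> measurable (bandit_space mu) (count_space UNIV)"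
    unfolding out_arm_def
    by (rule measurable_compose[where g = "\<lambda>a. case a of Stop i \<Rightarrow> i | Sample i \<Rightarrow> i"])
       (rule measurable_compose_countable[OF measurable_action[OF assms] st], simp)
  have [measurable]: "(\<lambda>\<omega>. ?p \<omega> (out_arm A (?p \<omega>) (?u \<omega>) (snd \<omega>))) \<in> borel_measurable (bandit_space mu)"
    by (rule measurable_compose_countable[OF measurable_mean oa])
  have "success_event A mu \<eta> \<epsilon> = {\<omega>\<in>space (bandit_space mu). stops A (?p \<omega>) (?u \<omega>) (snd \<omega>) \<and>
      ?p \<omega> (out_arm A (?p \<omega>) (?u \<omega>) (snd \<omega>)) \<ge> Ginv mu (1 - \<eta>) - \<epsilon>}"
    by (auto simp: success_event_def)
  also have "\<dots> \<in> events" unfolding stops_def by measurable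
  finally show ?thesis .
qed

lemma prob_arm:
  assumes "Measurable.pred arm_space P"
  shows "prob {\<omega>\<in>space (bandit_space mu). P (arm i \<omega>)} = measure arm_space {z\<in>space arm_space. P z}"
proof -
  have A: "{z\<in>space arm_space. P z} \<in> sets arm_space" using assms by measurable
  have "{\<omega>\<in>space (bandit_space mu). P (arm i \<omega>)} = arm i -` {z\<in>space arm_space. P z} \<inter> space (bandit_space mu)"
    using measurable_space[OF measurable_arm] by auto
  then show ?thesis
    using emeasure_arm[OF A, of i] by (simp only: measure_def)
qed

lemma indep_vars_arm_pred:
  assumes "Measurable.pred arm_space P"
  shows "indep_vars (\<lambda>_. count_space UNIV) (\<lambda>i \<omega>. P (arm i \<omega>)) I"
proof -
  have "indep_vars (\<lambda>_. arm_space) arm I"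
    by (rule indep_vars_subset[OF indep_vars_arm]) simp
  then show ?thesis by (rule indep_vars_compose2) (rule assms)
qed

end

section \<open>Sampling the arms one after the other\<close>

lemma hist_after_stop:
  assumes "stops_at A p u s m" "m \<le> n"
  shows "hist A p u s n = hist A p u s m"
  using assms(2)
proof (induction n rule: dec_induct)
  case (step n)
  then show ?case using assms(1) by (auto simp: stops_at_def)
qed simp

lemma stop_time_le:
  assumes "stops_at A p u s n"
  shows "stop_time A p u s \<le> n"
  unfolding stop_time_def using assms by (rule Least_le)

text \<open>The history is frozen after stopping, so the output can be read off at any stopped time,
  not just at the least one.\<close>

lemma out_arm_eq:
  assumes "A s (hist A p u s n) = Stop i"
  shows "out_arm A p u s = i"
proof -
  have n: "stops_at A p u s n" using assms by (auto simp: stops_at_def)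
  then have "stops_at A p u s (stop_time A p u s)"
    unfolding stop_time_def by (rule LeastI)
  then have "hist A p u s n = hist A p u s (stop_time A p u s)"
    using stop_time_le[OF n] by (rule hist_after_stop)
  then show ?thesis using assms by (simp add: out_arm_def)
qed

lemma successes_0 [simp]: "successes 0 z = 0"
  by (simp add: successes_def)

lemma successes_Suc: "successes (Suc n) z = successes n z + of_bool (snd z n < fst z)"
proof -
  have "{k \<in> {..<Suc n}. snd z k < fst z}
      = (if snd z n < fst z then insert n {k \<in> {..<n}. snd z k < fst z} else {k \<in> {..<n}. snd z k < fst z})"
    by (auto simp: less_Suc_eq)
  then show ?thesis by (simp add: successes_def)
qed

text \<open>The arms \<open>0, \<dots>, N - 1\<close> are sampled one after the other, arm \<open>i\<close> exactly \<open>len i\<close> times; \<open>acc\<close> sees the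
  success counts of all arms. If no arm is accepted, the output \<open>0\<close> is arbitrary.\<close>

definition sweep_alg :: "(nat \<Rightarrow> nat) \<Rightarrow> nat \<Rightarrow> ((nat \<Rightarrow> nat) \<Rightarrow> nat \<Rightarrow> bool) \<Rightarrow> algorithm" where
  "sweep_alg len N acc s h =
     (if h = [] then Sample 0
      else let i = fst (last h) in
        if length (filter (\<lambda>x. fst x = i) h) < len i then Sample i
        else if acc (\<lambda>j. count_list h (j, True)) i then Stop i
        else if Suc i < N then Sample (Suc i)
        else Stop 0)"

text \<open>\<open>acc_cong\<close> restricts the verdict on arm \<open>i\<close> to the counts of
  arms up to \<open>i\<close>, all of which are final once the block of arm \<open>i\<close> is
  complete.\<close>

locale sweep =
  fixes len :: "nat \<Rightarrow> nat" and N :: nat and acc :: "(nat \<Rightarrow> nat) \<Rightarrow> nat \<Rightarrow> bool"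
    and p :: "nat \<Rightarrow> real" and u :: "nat \<times> nat \<Rightarrow> real" and s :: "nat \<Rightarrow> real"
  assumes len_pos: "0 < len i" and N_pos: "0 < N"
    and acc_cong: "(\<And>j. j \<le> i \<Longrightarrow> c j = c' j) \<Longrightarrow> acc c i = acc c' i"
begin

abbreviation "A \<equiv> sweep_alg len N acc"

definition block :: "nat \<Rightarrow> nat \<Rightarrow> history" where
  "block j k = map (\<lambda>t. (j, u (j, t) < p j)) [0..<k]"

definition blocks :: "nat \<Rightarrow> history" where
  "blocks j = concat (map (\<lambda>i. block i (len i)) [0..<j])"

text \<open>The verdict computed offline from the full success counts of all arms; the run is shown
  to agree with it.\<close>

definition hit :: "nat \<Rightarrow> bool" where
  "hit i = acc (\<lambda>j. successes (len j) (p j, \<lambda>k. u (j, k))) i"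

lemma blocks_0 [simp]: "blocks 0 = []" and block_0 [simp]: "block j 0 = []"
  by (simp_all add: blocks_def block_def)

lemma block_Suc: "block j (Suc k) = block j k @ [(j, u (j, k) < p j)]"
  by (simp add: block_def)

lemma blocks_Suc: "blocks (Suc j) = blocks j @ block j (len j)"
  by (simp add: blocks_def)

lemma length_filter_block: "length (filter (\<lambda>x. fst x = i) (block j k)) = (if i = j then k else 0)"
  by (induction k) (simp_all add: block_Suc)

lemma filter_blocks: "j \<le> i \<Longrightarrow> filter (\<lambda>x. fst x = i) (blocks j) = []"
proof (induction j)
  case (Suc j)
  then show ?case using length_filter_block[of i j "len j"] by (simp add: blocks_Suc)
qed simp

lemma length_filter_current [simp]: "length (filter (\<lambda>x. fst x = j) (blocks j @ block j k)) = k"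
  by (simp add: filter_blocks length_filter_block)

lemma count_list_block:
  "count_list (block j k) (i, True) = (if i = j then successes k (p j, \<lambda>k. u (j, k)) else 0)"
  by (induction k) (auto simp: block_Suc successes_Suc)

lemma count_list_blocks:
  "count_list (blocks j) (i, True) = (if i < j then successes (len i) (p i, \<lambda>k. u (i, k)) else 0)"
  by (induction j) (auto simp: blocks_Suc count_list_block less_Suc_eq)

lemma A_blocks_Suc:
  "A s (blocks (Suc j)) = (if hit j then Stop j else if Suc j < N then Sample (Suc j) else Stop 0)"
proof -
  have "block j (len j) \<noteq> [] \<and> fst (last (block j (len j))) = j"
    using len_pos[of j] by (cases "len j") (simp_all add: block_Suc)
  then have "blocks (Suc j) \<noteq> []" "fst (last (blocks (Suc j))) = j"
    by (auto simp: blocks_Suc)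
  moreover have "length (filter (\<lambda>x. fst x = j) (blocks (Suc j))) = len j"
    by (simp only: blocks_Suc length_filter_current)
  \<comment> \<open>The history has count 0 for arms beyond \<open>j\<close>, whereas
    \<open>hit\<close> uses their full counts; \<open>acc_cong\<close> makes the two verdicts
    agree.\<close>
  moreover have "acc (\<lambda>i. count_list (blocks (Suc j)) (i, True)) j = hit j"
    unfolding hit_def by (rule acc_cong) (simp add: count_list_blocks)
  ultimately show ?thesis by (simp add: sweep_alg_def)
qed

lemma A_block:
  assumes "j < N" "\<And>i. i < j \<Longrightarrow> \<not> hit i" "k < len j"
  shows "A s (blocks j @ block j k) = Sample j"
proof (cases k)
  \<comment> \<open>With an empty current block the last sampled arm is \<open>j - 1\<close>,
    complete and rejected, so the algorithm moves on; for \<open>j = 0\<close> the history is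
    empty.\<close>
  case 0
  then show ?thesis using assms A_blocks_Suc[of "j - 1"]
    by (cases j) (simp_all add: sweep_alg_def)
next
  case (Suc k')
  then have "blocks j @ block j k \<noteq> []" "fst (last (blocks j @ block j k)) = j"
    by (simp_all add: block_Suc)
  then show ?thesis using assms(3) length_filter_current[of j k]
    unfolding sweep_alg_def by (simp add: Let_def del: append_is_Nil_conv filter_append length_filter_current)
qed

lemma hist_block:
  assumes "j < N" "\<And>i. i < j \<Longrightarrow> \<not> hit i" "k \<le> len j"
    and "hist A p u s n = blocks j"
  shows "hist A p u s (n + k) = blocks j @ block j k"
  using assms(3)
proof (induction k)
  case (Suc k)
  have "reward p u (blocks j @ block j k) j = (u (j, k) < p j)"
    unfolding reward_def length_filter_current ..
  then show ?case using Suc A_block[OF assms(1,2), of k]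
    by (simp add: block_Suc)
qed (simp add: assms)

text \<open>Arm \<open>j - 1\<close> itself may be a hit: the bound \<open>Suc i < j\<close> lets
  the claim cover the moment right after the block of the accepted arm.\<close>

lemma hist_blocks:
  "j \<le> N \<Longrightarrow> (\<And>i. Suc i < j \<Longrightarrow> \<not> hit i) \<Longrightarrow> hist A p u s (\<Sum>i<j. len i) = blocks j"
proof (induction j)
  case (Suc j)
  have "hist A p u s (\<Sum>i<j. len i) = blocks j"
    using Suc.prems by (intro Suc.IH) auto
  then have "hist A p u s ((\<Sum>i<j. len i) + len j) = blocks j @ block j (len j)"
    using Suc.prems by (intro hist_block) auto
  then show ?case by (simp add: blocks_Suc)
qed simp

lemma stop_at_first_hit:
  assumes "j < N" "hit j" "\<And>i. i < j \<Longrightarrow> \<not> hit i"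
  shows "A s (hist A p u s (\<Sum>i<Suc j. len i)) = Stop j"
proof -
  have "hist A p u s (\<Sum>i<Suc j. len i) = blocks (Suc j)"
    using assms by (intro hist_blocks) auto
  then show ?thesis using assms by (simp add: A_blocks_Suc del: sum.lessThan_Suc)
qed

lemma stop_at_end:
  assumes "\<And>i. i < N \<Longrightarrow> \<not> hit i"
  shows "A s (hist A p u s (\<Sum>i<N. len i)) = Stop 0"
proof -
  obtain j where "N = Suc j" using N_pos by (cases N) auto
  moreover have "hist A p u s (\<Sum>i<N. len i) = blocks N"
    using assms by (intro hist_blocks) auto
  ultimately show ?thesis
    using assms A_blocks_Suc[of j] by (simp del: sum.lessThan_Suc)
qed

text \<open>An arm is charged its block only if all earlier arms are rejected. As a weighted sum of
  indicators the bound can be integrated term by term.\<close>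

lemma stops: "stops A p u s"
  and stop_time_bound: "stop_time A p u s \<le> (\<Sum>j<N. if \<forall>i<j. \<not> hit i then len j else 0)"
  and out_arm_hit: "\<exists>i<N. hit i \<Longrightarrow> out_arm A p u s < N \<and> hit (out_arm A p u s)"
proof -
  have "stops A p u s \<and> stop_time A p u s \<le> (\<Sum>j<N. if \<forall>i<j. \<not> hit i then len j else 0) \<and>
    ((\<exists>i<N. hit i) \<longrightarrow> out_arm A p u s < N \<and> hit (out_arm A p u s))"
  proof (cases "\<exists>i<N. hit i")
    case True
    define j where "j = (LEAST i. hit i)"
    have j: "hit j" "j < N" "\<And>i. i < j \<Longrightarrow> \<not> hit i"
      unfolding j_def using True by (auto intro: LeastI dest: not_less_Least Least_le[of hit] order_le_less_trans)
    have *: "A s (hist A p u s (\<Sum>i<Suc j. len i)) = Stop j"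
      using j by (intro stop_at_first_hit)
    then have st: "stops_at A p u s (\<Sum>i<Suc j. len i)" by (auto simp: stops_at_def)
    have "(\<Sum>i<Suc j. len i) = (\<Sum>i<Suc j. if \<forall>i'<i. \<not> hit i' then len i else 0)"
      by (intro sum.cong) (use j in auto)
    also have "\<dots> \<le> (\<Sum>j<N. if \<forall>i<j. \<not> hit i then len j else 0)"
      by (intro sum_mono2) (use j in auto)
    finally show ?thesis
      using st stop_time_le[OF st] out_arm_eq[where A = A and p = p and u = u, OF *] j unfolding stops_def by force
  next
    case False
    then have *: "A s (hist A p u s (\<Sum>i<N. len i)) = Stop 0"
      by (intro stop_at_end) auto
    then have st: "stops_at A p u s (\<Sum>i<N. len i)" by (auto simp: stops_at_def)
    have "(\<Sum>i<N. len i) = (\<Sum>j<N. if \<forall>i<j. \<not> hit i then len j else 0)"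
      by (intro sum.cong) (use False in auto)
    then show ?thesis
      using st stop_time_le[OF st] False unfolding stops_def by auto
  qed
  then show "stops A p u s"
    and "stop_time A p u s \<le> (\<Sum>j<N. if \<forall>i<j. \<not> hit i then len j else 0)"
    and "\<exists>i<N. hit i \<Longrightarrow> out_arm A p u s < N \<and> hit (out_arm A p u s)"
    by blast+
qed

end

lemma bandit_alg_sweep: "bandit_alg (sweep_alg len N acc)"
  by (simp add: bandit_alg_def sweep_alg_def)

section \<open>The two-phase algorithm\<close>

text \<open>Fewer than \<open>\<eta> M / 2\<close> phase-one estimates exceed the estimate of arm \<open>i\<close> plus \<open>\<epsilon> / 2\<close>: a comparison with
  the empirical quantile that avoids order statistics. Phase two uses the arms \<open>M, \<dots>, 2M - 1\<close>.\<close>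

definition accept :: "nat \<Rightarrow> nat \<Rightarrow> nat \<Rightarrow> real \<Rightarrow> real \<Rightarrow> (nat \<Rightarrow> nat) \<Rightarrow> nat \<Rightarrow> bool" where
  "accept M L K \<eta> \<epsilon> c i \<longleftrightarrow>
     M \<le> i \<and> real (card {j\<in>{..<M}. real (c j) / L > real (c i) / K + \<epsilon> / 2}) < \<eta> * M / 2"

definition quantile_alg :: "nat \<Rightarrow> nat \<Rightarrow> nat \<Rightarrow> real \<Rightarrow> real \<Rightarrow> algorithm" where
  "quantile_alg M L K \<eta> \<epsilon> = sweep_alg (\<lambda>i. if i < M then L else K) (M + M) (accept M L K \<eta> \<epsilon>)"

text \<open>\<open>M_bound\<close> feeds the Chernoff bounds and the chance that every test fails,
  \<open>L_bound\<close> the misjudgement of a phase-one arm, the first \<open>K_bound\<close> the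
  union bound over the tests, the second the acceptance of a good fresh arm. Each estimate is
  allowed an error of \<epsilon>/4.\<close>

locale quantile_bandit = bandit +
  fixes M L K :: nat and \<eta> \<epsilon> \<delta> :: real
  assumes eta: "0 < \<eta>" "\<eta> \<le> 1/2" and eps: "0 < \<epsilon>" and delta: "0 < \<delta>"
    and M_pos: "0 < M" and L_pos: "0 < L" and K_pos: "0 < K"
    and M_bound: "exp (- \<eta> * M / 16) \<le> \<delta> / 8"
    and L_bound: "exp (- 2 * real L * (\<epsilon> / 4)\<^sup>2) \<le> \<eta> / 8"
    and K_bound: "exp (- 2 * real K * (\<epsilon> / 4)\<^sup>2) \<le> \<delta> / (8 * real M)" "exp (- 2 * real K * (\<epsilon> / 4)\<^sup>2) \<le> 1 / 8"
begin

abbreviation "\<Omega> \<equiv> space (bandit_space mu)"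

text \<open>True quantiles meant to enclose the empirical one: mass at least \<eta> lies at or above
  \<open>q\<close>, at most \<eta>/8 strictly above \<open>q'\<close>. The threshold \<eta>/2 is a
  constant factor away from both.\<close>

definition "q = Ginv mu (1 - \<eta>)"
definition "q' = Ginv mu (1 - \<eta> / 8)"

abbreviation "est n i \<omega> \<equiv> real (successes n (arm i \<omega>)) / n"

text \<open>The four failure events: the first two say that the empirical quantile of phase one is too low,
  respectively too high.\<close>

definition "few_high = {\<omega>\<in>\<Omega>. real (card {i\<in>{..<M}. est L i \<omega> \<ge> q - \<epsilon> / 4}) \<le> \<eta> * M / 2}"
definition "many_high = {\<omega>\<in>\<Omega>. real (card {i\<in>{..<M}. est L i \<omega> > q' + \<epsilon> / 4}) \<ge> \<eta> * M / 2}"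
definition "bad_high = {\<omega>\<in>\<Omega>. \<exists>i\<in>{M..<M+M}. fst (arm i \<omega>) \<le> q - \<epsilon> \<and> est K i \<omega> \<ge> q - \<epsilon> + \<epsilon> / 4}"
definition "none_high n = {\<omega>\<in>\<Omega>. \<forall>i\<in>{M..<M+n}. \<not> est K i \<omega> \<ge> q' - \<epsilon> / 4}"

lemma events_measurable [measurable]: "few_high \<in> events" "many_high \<in> events" "bad_high \<in> events" "none_high n \<in> events"
proof -
  have "(\<lambda>\<omega>. card {i. i < M \<and> est L i \<omega> \<ge> q - \<epsilon> / 4}) \<in> measurable (bandit_space mu) (count_space UNIV)"
    "(\<lambda>\<omega>. card {i. i < M \<and> est L i \<omega> > q' + \<epsilon> / 4}) \<in> measurable (bandit_space mu) (count_space UNIV)"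
    by (rule measurable_card, measurable)+
  note [measurable] = this[folded lessThan_iff]
  show "few_high \<in> events" "many_high \<in> events" "none_high n \<in> events"
    unfolding few_high_def many_high_def none_high_def by measurable
  have "(\<lambda>\<omega>. fst (arm i \<omega>)) \<in> borel_measurable (bandit_space mu)" for i
    using measurable_mean[of i] by (simp add: arm_def)
  note [measurable] = this
  show "bad_high \<in> events"
    unfolding bad_high_def by measurable
qed

section \<open>Probabilities of the failure events\<close>

lemma measure_q: "measure mu {q..} \<ge> \<eta>"
  using measure_atLeast_Ginv[of "1 - \<eta>"] eta by (simp add: q_def)

lemma measure_q': "measure mu {q'..} \<ge> \<eta> / 8" "measure mu {q'<..} \<le> \<eta> / 8"
  using measure_atLeast_Ginv[of "1 - \<eta> / 8"] measure_greaterThan_Ginv[of "1 - \<eta> / 8"] eta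
  by (simp_all add: q'_def)

text \<open>An arm is counted whenever its mean reaches \<open>q\<close> and is not underestimated,
  hence with probability at least \<eta> (1 - \<eta>/8) \<ge> 7\<eta>/8.\<close>

lemma prob_few_high: "prob few_high \<le> \<delta> / 8"
proof -
  have "prob few_high \<le> exp (\<eta> * M / 2 * ln 2 - 7 * \<eta> / 8 * card {..<M} / 2)"
    unfolding few_high_def
  proof (rule prob_card_less_le[OF indep_vars_arm_pred])
    show "Measurable.pred arm_space (\<lambda>z. real (successes L z) / L \<ge> q - \<epsilon> / 4)" by measurable
    then have "prob {\<omega>\<in>\<Omega>. est L i \<omega> \<ge> q - \<epsilon> / 4}
        = measure arm_space {z\<in>space arm_space. real (successes L z) / L \<ge> q - \<epsilon> / 4}" for i
      by (rule prob_arm)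
    moreover have "7 * \<eta> / 8 \<le> measure mu {q..} * (1 - exp (- 2 * real L * (\<epsilon> / 4)\<^sup>2))"
      using mult_mono[OF measure_q, of "7/8" "1 - exp (- 2 * real L * (\<epsilon> / 4)\<^sup>2)"] L_bound eta by simp
    ultimately show "7 * \<eta> / 8 \<le> prob {\<omega>\<in>\<Omega>. est L i \<omega> \<ge> q - \<epsilon> / 4}" for i
      using prob_good_estimate_ge[OF L_pos, of "\<epsilon> / 4" q] eps by simp
  qed simp
  \<comment> \<open>The exponent is \<eta> M ((ln 2)/2 - 7/16), so ln 2 \<le> 3/4 is what is
    needed.\<close>
  also have "\<dots> \<le> exp (- \<eta> * M / 16)"
    using mult_left_mono[OF ln2_le_25_over_36, of "\<eta> * M"] eta mult_nonneg_nonneg[of \<eta> M]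
    by (simp add: algebra_simps)
  finally show ?thesis using M_bound by simp
qed

text \<open>Means above \<open>q'\<close> contribute at most \<eta>/8 and overestimates at most
  \<eta>/8, so an arm is counted with probability at most \<eta>/4.\<close>

lemma prob_many_high: "prob many_high \<le> \<delta> / 8"
proof -
  have "prob many_high \<le> exp (\<eta> / 4 * card {..<M} - \<eta> * M / 2 * ln 2)"
    unfolding many_high_def
  proof (rule prob_card_ge_le[OF indep_vars_arm_pred])
    show "Measurable.pred arm_space (\<lambda>z. real (successes L z) / L > q' + \<epsilon> / 4)" by measurable
    then have "prob {\<omega>\<in>\<Omega>. est L i \<omega> > q' + \<epsilon> / 4}
        = measure arm_space {z\<in>space arm_space. real (successes L z) / L > q' + \<epsilon> / 4}" for i
      by (rule prob_arm)
    then show "prob {\<omega>\<in>\<Omega>. est L i \<omega> > q' + \<epsilon> / 4} \<le> \<eta> / 4" for i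
      using prob_estimate_gt_le[OF L_pos, of "\<epsilon> / 4" q'] eps L_bound measure_q'(2) by simp
  qed simp
  \<comment> \<open>The exponent is \<eta> M (1/4 - (ln 2)/2), so ln 2 \<ge> 5/8 is what is
    needed.\<close>
  also have "\<dots> \<le> exp (- \<eta> * M / 16)"
    using mult_left_mono[OF ln2_ge_two_thirds, of "\<eta> * M"] eta mult_nonneg_nonneg[of \<eta> M]
    by (simp add: algebra_simps)
  finally show ?thesis using M_bound by simp
qed

lemma prob_bad_high: "prob bad_high \<le> \<delta> / 8"
proof -
  let ?P = "\<lambda>z. fst z \<le> q - \<epsilon> \<and> real (successes K z) / K \<ge> q - \<epsilon> + \<epsilon> / 4"
  have P: "Measurable.pred arm_space ?P" by measurable
  have ev: "{\<omega>\<in>\<Omega>. ?P (arm i \<omega>)} \<in> events" for i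
    using measurable_compose[OF measurable_arm P] by (simp add: pred_def)
  have "prob {\<omega>\<in>\<Omega>. ?P (arm i \<omega>)} \<le> exp (- 2 * real K * (\<epsilon> / 4)\<^sup>2)" for i
    unfolding prob_arm[OF P] using K_pos eps by (intro prob_overestimate_le) auto
  note p = order_trans[OF this K_bound(1)]
  have eq: "bad_high = (\<Union>i\<in>{M..<M+M}. {\<omega>\<in>\<Omega>. ?P (arm i \<omega>)})"
    unfolding bad_high_def by blast
  have "prob bad_high \<le> (\<Sum>i\<in>{M..<M+M}. prob {\<omega>\<in>\<Omega>. ?P (arm i \<omega>)})"
    unfolding eq by (rule finite_measure_subadditive_finite, simp, rule image_subsetI, rule ev)
  also have "\<dots> \<le> (\<Sum>i\<in>{M..<M+M}. \<delta> / (8 * real M))"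
    by (intro sum_mono p)
  also have "\<dots> = \<delta> / 8" using M_pos by simp
  finally show ?thesis .
qed

text \<open>A fresh arm has mean at least \<open>q'\<close> with probability at least \<eta>/8 and
  is then not underestimated with probability at least 7/8; the product exceeds \<eta>/16. General
  \<open>n\<close> serves the running time, \<open>n = M\<close> the success probability.\<close>

lemma prob_none_high: "prob (none_high n) \<le> (1 - \<eta> / 16) ^ n"
proof -
  let ?P = "\<lambda>z. real (successes K z) / K \<ge> q' - \<epsilon> / 4"
  have P: "Measurable.pred arm_space ?P" by measurable
  have "\<eta> / 8 * (7 / 8) \<le> measure mu {q'..} * (1 - exp (- 2 * real K * (\<epsilon> / 4)\<^sup>2))"
    using K_bound(2) measure_q'(1) eta by (intro mult_mono) auto
  then have "\<eta> / 16 \<le> prob {\<omega>\<in>\<Omega>. ?P (arm i \<omega>)}" for i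
    using prob_good_estimate_ge[OF K_pos, of "\<epsilon> / 4" q'] eps eta by (simp add: prob_arm[OF P])
  then have "(\<Prod>i\<in>{M..<M+n}. 1 - prob {\<omega>\<in>\<Omega>. ?P (arm i \<omega>)}) \<le> (\<Prod>i\<in>{M..<M+n}. 1 - \<eta> / 16)"
    by (intro prod_mono) auto
  then show ?thesis
    unfolding none_high_def using prob_none[OF indep_vars_arm_pred[OF P], of "{M..<M+n}"] by simp
qed

lemma prob_none_high_M: "prob (none_high M) \<le> \<delta> / 8"
proof -
  have "(1 - \<eta> / 16) ^ M \<le> exp (- \<eta> / 16) ^ M"
    using exp_ge_add_one_self[of "- \<eta> / 16"] eta by (intro power_mono) auto
  also have "\<dots> = exp (- \<eta> * M / 16)"
    using exp_of_nat2_mult[of "- \<eta> / 16" M] by (simp add: algebra_simps)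
  finally show ?thesis using prob_none_high[of M] M_bound by simp
qed

section \<open>Correctness outside the failure events\<close>

abbreviation "A \<equiv> quantile_alg M L K \<eta> \<epsilon>"

lemma run_sweep: "sweep (\<lambda>i. if i < M then L else K) (M + M) (accept M L K \<eta> \<epsilon>)"
proof
  fix i and c c' :: "nat \<Rightarrow> nat"
  assume eq: "\<And>j. j \<le> i \<Longrightarrow> c j = c' j"
  show "accept M L K \<eta> \<epsilon> c i = accept M L K \<eta> \<epsilon> c' i"
  proof (cases "M \<le> i")
    case True
    then have "{j\<in>{..<M}. real (c j) / L > real (c i) / K + \<epsilon> / 2} = {j\<in>{..<M}. real (c' j) / L > real (c' i) / K + \<epsilon> / 2}"
      using eq by auto
    then show ?thesis by (simp add: accept_def)
  qed (simp add: accept_def)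
qed (use M_pos L_pos K_pos in auto)

definition "hits \<omega> i = sweep.hit (\<lambda>i. if i < M then L else K) (accept M L K \<eta> \<epsilon>) (fst (fst \<omega>)) (snd (fst \<omega>)) i"

lemma hits_iff:
  "hits \<omega> i \<longleftrightarrow> M \<le> i \<and> real (card {j\<in>{..<M}. est L j \<omega> > est K i \<omega> + \<epsilon> / 2}) < \<eta> * M / 2"
proof (cases "M \<le> i")
  case True
  have "{j\<in>{..<M}. real (successes (if j < M then L else K) (arm j \<omega>)) / L > est K i \<omega> + \<epsilon> / 2}
      = {j\<in>{..<M}. est L j \<omega> > est K i \<omega> + \<epsilon> / 2}" by auto
  then show ?thesis using True
    by (simp add: hits_def sweep.hit_def[OF run_sweep] accept_def flip: arm_def)
qed (simp add: hits_def sweep.hit_def[OF run_sweep] accept_def)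

text \<open>The estimate plus \<epsilon>/2 is at least q' + \<epsilon>/4, and outside
  \<open>many_high\<close> fewer than \<eta>M/2 phase-one estimates exceed that.\<close>

lemma hits_if_high:
  assumes \<omega>: "\<omega> \<in> \<Omega>" "\<omega> \<notin> many_high" and i: "M \<le> i" "est K i \<omega> \<ge> q' - \<epsilon> / 4"
  shows "hits \<omega> i"
proof -
  have "card {j\<in>{..<M}. est L j \<omega> > est K i \<omega> + \<epsilon> / 2} \<le> card {j\<in>{..<M}. est L j \<omega> > q' + \<epsilon> / 4}"
    using i by (intro card_mono) auto
  then show ?thesis using \<omega> i(1) by (simp add: many_high_def hits_iff)
qed

text \<open>Were the estimate below q - 3\<epsilon>/4, all phase-one estimates of at least q -
  \<epsilon>/4, more than \<eta>M/2 outside \<open>few_high\<close>, would exceed it by more than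
  \<epsilon>/2. So it is at least q - 3\<epsilon>/4, and a mean of at most q - \<epsilon> would put
  the outcome into \<open>bad_high\<close>.\<close>

lemma mean_if_hits:
  assumes \<omega>: "\<omega> \<in> \<Omega>" "\<omega> \<notin> few_high" "\<omega> \<notin> bad_high" and i: "hits \<omega> i" "i < M + M"
  shows "fst (fst \<omega>) i \<ge> q - \<epsilon>"
proof -
  have i': "M \<le> i" "real (card {j\<in>{..<M}. est L j \<omega> > est K i \<omega> + \<epsilon> / 2}) < \<eta> * M / 2"
    using i(1) by (auto simp: hits_iff)
  have "est K i \<omega> \<ge> q - \<epsilon> + \<epsilon> / 4"
  proof (rule ccontr)
    assume "\<not> est K i \<omega> \<ge> q - \<epsilon> + \<epsilon> / 4"
    then have "card {j\<in>{..<M}. est L j \<omega> \<ge> q - \<epsilon> / 4} \<le> card {j\<in>{..<M}. est L j \<omega> > est K i \<omega> + \<epsilon> / 2}"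
      by (intro card_mono) auto
    then show False using i'(2) \<omega> by (simp add: few_high_def)
  qed
  then have "\<not> fst (arm i \<omega>) \<le> q - \<epsilon>"
    using \<omega> i(2) i'(1) by (auto simp: bad_high_def)
  then show ?thesis by (simp add: arm_def)
qed

lemma success_if_good:
  assumes "\<omega> \<in> \<Omega>" "\<omega> \<notin> few_high \<union> many_high \<union> (bad_high \<union> none_high M)"
  shows "\<omega> \<in> success_event A mu \<eta> \<epsilon>"
proof -
  obtain p u s where \<omega>: "\<omega> = ((p, u), s)" by (metis prod.exhaust)
  interpret S: sweep "\<lambda>i. if i < M then L else K" "M + M" "accept M L K \<eta> \<epsilon>" p u s
    by (rule run_sweep)
  have hit: "S.hit i = hits \<omega> i" for i by (simp add: hits_def \<omega>)
  \<comment> \<open>Outside \<open>none_high M\<close> and \<open>many_high\<close> some fresh arm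
    is accepted, so the default output 0 is not reached.\<close>
  obtain i where "i \<in> {M..<M+M}" "est K i \<omega> \<ge> q' - \<epsilon> / 4"
    using assms by (auto simp: none_high_def)
  then have "\<exists>i<M+M. S.hit i"
    unfolding hit using hits_if_high[of \<omega> i] assms by auto
  then have out: "out_arm A p u s < M + M" "hits \<omega> (out_arm A p u s)"
    using S.out_arm_hit by (auto simp: hit quantile_alg_def)
  have "p (out_arm A p u s) \<ge> q - \<epsilon>"
    using mean_if_hits[OF _ _ _ out(2,1)] assms by (simp add: \<omega>)
  moreover have "stops A p u s" using S.stops by (simp add: quantile_alg_def)
  ultimately show ?thesis using assms(1) by (simp add: success_event_def \<omega> q_def)
qed

lemma bandit_alg_A: "bandit_alg A"
  unfolding quantile_alg_def by (rule bandit_alg_sweep)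

lemma prob_success: "prob (success_event A mu \<eta> \<epsilon>) \<ge> 1 - \<delta>"
proof -
  let ?B = "few_high \<union> many_high \<union> (bad_high \<union> none_high M)"
  have "prob ?B \<le> prob (few_high \<union> many_high) + prob (bad_high \<union> none_high M)"
    by (rule measure_Un_le) auto
  also have "prob (few_high \<union> many_high) \<le> prob few_high + prob many_high"
    by (rule measure_Un_le) auto
  also have "prob (bad_high \<union> none_high M) \<le> prob bad_high + prob (none_high M)"
    by (rule measure_Un_le) auto
  finally have "prob ?B \<le> \<delta>"
    using prob_few_high prob_many_high prob_bad_high prob_none_high_M delta by simp
  then have "1 - \<delta> \<le> 1 - prob ?B" by simp
  also have "\<dots> = prob (\<Omega> - ?B)"
    by (rule prob_compl[symmetric]) auto
  also have "\<dots> \<le> prob (success_event A mu \<eta> \<epsilon>)"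
    using success_if_good by (intro finite_measure_mono success_event_measurable bandit_alg_A) blast
  finally show ?thesis .
qed

section \<open>Expected number of samples\<close>

lemma sample_complexity_bound:
  assumes \<omega>: "((p, u), s) \<in> \<Omega>"
  shows "sample_complexity A p u s
    \<le> ennreal (real M * real L + real K * (\<Sum>n<M. indicator (none_high n) ((p, u), s) + indicator many_high ((p, u), s) :: real))"
proof -
  let ?f = "\<lambda>n. indicator (none_high n) ((p, u), s) + indicator many_high ((p, u), s) :: real"
  interpret S: sweep "\<lambda>i. if i < M then L else K" "M + M" "accept M L K \<eta> \<epsilon>" p u s
    by (rule run_sweep)
  let ?\<omega> = "((p, u), s)"
  let ?t = "\<lambda>j. if \<forall>i<j. \<not> S.hit i then if j < M then L else K else 0"
  have hit: "S.hit i = hits ?\<omega> i" for i by (simp add: hits_def)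
  have split: "(\<Sum>j<M+n. ?t j) = (\<Sum>j<M. ?t j) + (\<Sum>j<n. ?t (M + j))" for n
    by (induction n) simp_all
  have "real (\<Sum>j<M. ?t j) \<le> real (\<Sum>j<M. L)"
    unfolding of_nat_le_iff by (rule sum_mono) auto
  also have "\<dots> = real M * real L" by simp
  finally have 1: "real (\<Sum>j<M. ?t j) \<le> real M * real L" .
  \<comment> \<open>Arm \<open>M + j\<close> is paid for only if the \<open>j\<close> fresh arms
    before it are rejected; outside \<open>many_high\<close> this forces
    \<open>none_high j\<close>.\<close>
  have 2: "real (?t (M + j)) \<le> real K * ?f j" for j
  proof (cases "?\<omega> \<in> none_high j \<or> ?\<omega> \<in> many_high")
    case True
    then have "1 \<le> ?f j" by (auto simp: indicator_def)
    then have "real K * 1 \<le> real K * ?f j" by (intro mult_left_mono) auto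
    then show ?thesis by auto
  next
    case False
    then obtain i where "i \<in> {M..<M+j}" "est K i ?\<omega> \<ge> q' - \<epsilon> / 4"
      using \<omega> by (auto simp: none_high_def)
    then have "\<exists>i<M+j. S.hit i"
      using hits_if_high[OF \<omega>, of i] False by (auto simp: hit)
    then show ?thesis by auto
  qed
  have "real (stop_time A p u s) \<le> real (\<Sum>j<M+M. ?t j)"
    using S.stop_time_bound unfolding quantile_alg_def of_nat_le_iff .
  also have "\<dots> = real (\<Sum>j<M. ?t j) + (\<Sum>j<M. real (?t (M + j)))"
    unfolding split by simp
  also have "\<dots> \<le> real M * real L + (\<Sum>j<M. real K * ?f j)"
    by (intro add_mono 1 sum_mono 2)
  also have "\<dots> = real M * real L + real K * sum ?f {..<M}" by (simp add: sum_distrib_left)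
  finally have "ennreal (real (stop_time A p u s)) \<le> ennreal (real M * real L + real K * sum ?f {..<M})"
    by (rule ennreal_leI)
  moreover have "stops A p u s" using S.stops by (simp add: quantile_alg_def)
  ultimately show ?thesis by (simp add: sample_complexity_def ennreal_of_nat_eq_real_of_nat)
qed

text \<open>A geometric series of ratio 1 - \<eta>/16, bounded independently of
  \<open>M\<close>.\<close>

lemma sum_prob_none_high: "(\<Sum>n<M. prob (none_high n)) \<le> 16 / \<eta>"
proof -
  have "\<eta> / 16 * (\<Sum>n<M. (1 - \<eta> / 16) ^ n) = 1 - (1 - \<eta> / 16) ^ M"
    using one_diff_power_eq[of "1 - \<eta> / 16" M] by simp
  also have "\<dots> \<le> 1" using eta by simp
  finally have "(\<Sum>n<M. (1 - \<eta> / 16) ^ n) \<le> 16 / \<eta>" using eta by (simp add: field_simps)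
  moreover have "(\<Sum>n<M. prob (none_high n)) \<le> (\<Sum>n<M. (1 - \<eta> / 16) ^ n)"
    by (intro sum_mono prob_none_high)
  ultimately show ?thesis by simp
qed

text \<open>On \<open>many_high\<close> all \<open>M\<close> tests may be paid; its probability
  \<delta>/8 yields the term \<open>M * (\<delta> / 8)\<close>.\<close>

lemma expected_samples_bound:
  "expected_samples A mu \<le> ennreal (real M * real L + real K * (16 / \<eta> + M * (\<delta> / 8)))"
proof -
  let ?g = "\<lambda>\<omega>. real M * real L + real K * (\<Sum>n<M. indicator (none_high n) \<omega> + indicator many_high \<omega> :: real)"
  have int: "integrable (bandit_space mu) (indicator B :: _ \<Rightarrow> real)" if "B \<in> events" for B
    using that by (simp add: emeasure_eq_measure)
  have intg: "integrable (bandit_space mu) ?g"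
    by (intro Bochner_Integration.integrable_add integrable_const integrable_mult_right
        Bochner_Integration.integrable_sum int events_measurable)
  have "expected_samples A mu \<le> (\<integral>\<^sup>+\<omega>. ennreal (?g \<omega>) \<partial>bandit_space mu)"
    unfolding expected_samples_def
    by (intro nn_integral_mono) (auto split: prod.split intro!: sample_complexity_bound)
  also have "\<dots> = ennreal (expectation ?g)"
    by (intro nn_integral_eq_integral intg AE_I2 add_nonneg_nonneg mult_nonneg_nonneg sum_nonneg) auto
  also have "expectation ?g = real M * real L + real K * (\<Sum>n<M. prob (none_high n) + prob many_high)"
    by (simp add: Bochner_Integration.integral_add Bochner_Integration.integral_sum int prob_space
        Bochner_Integration.integrable_sum Bochner_Integration.integrable_add Int_absorb2 sets.sets_into_space)
  also have "\<dots> \<le> real M * real L + real K * (16 / \<eta> + M * (\<delta> / 8))"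
    using sum_prob_none_high mult_left_mono[OF prob_many_high, of "real M"]
    by (intro add_left_mono mult_left_mono) (auto simp: sum.distrib intro!: add_mono mult_left_mono)
  finally show ?thesis by (simp add: ennreal_leI)
qed

end

section \<open>Choice of the parameters\<close>

text \<open>Solves exp (- \<eta> M / 16) \<le> \<delta>/8 for M.\<close>

definition num_arms :: "real \<Rightarrow> real \<Rightarrow> nat" where
  "num_arms \<eta> \<delta> = nat \<lceil>16 / \<eta> * ln (8 / \<delta>)\<rceil>"

text \<open>Solves Hoeffding's exp (- 2 n (\<epsilon>/4)^2) \<le> \<alpha> for n, where 2
  (\<epsilon>/4)^2 = \<epsilon>^2/8.\<close>

definition num_samples :: "real \<Rightarrow> real \<Rightarrow> nat" where
  "num_samples \<epsilon> \<alpha> = nat \<lceil>8 / \<epsilon>\<^sup>2 * ln (1 / \<alpha>)\<rceil>"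

lemma num_samples_pos: "0 < \<epsilon> \<Longrightarrow> 0 < \<alpha> \<Longrightarrow> \<alpha> < 1 \<Longrightarrow> 0 < num_samples \<epsilon> \<alpha>"
  by (simp add: num_samples_def)

lemma exp_num_samples_le:
  assumes "0 < \<epsilon>" "0 < \<alpha>"
  shows "exp (- 2 * real (num_samples \<epsilon> \<alpha>) * (\<epsilon> / 4)\<^sup>2) \<le> \<alpha>"
proof -
  have "8 / \<epsilon>\<^sup>2 * ln (1 / \<alpha>) \<le> num_samples \<epsilon> \<alpha>"
    unfolding num_samples_def by (rule real_nat_ceiling_ge)
  then have "ln (1 / \<alpha>) \<le> 2 * real (num_samples \<epsilon> \<alpha>) * (\<epsilon> / 4)\<^sup>2"
    using assms by (simp add: field_simps power2_eq_square)
  then have "- 2 * real (num_samples \<epsilon> \<alpha>) * (\<epsilon> / 4)\<^sup>2 \<le> ln \<alpha>"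
    using assms by (simp add: ln_div)
  then show ?thesis using assms by (simp add: ln_ge_iff)
qed

lemma exp_num_arms_le:
  assumes "0 < \<eta>" "0 < \<delta>"
  shows "exp (- \<eta> * num_arms \<eta> \<delta> / 16) \<le> \<delta> / 8"
proof -
  have "16 / \<eta> * ln (8 / \<delta>) \<le> num_arms \<eta> \<delta>"
    unfolding num_arms_def by (rule real_nat_ceiling_ge)
  then have "- \<eta> * num_arms \<eta> \<delta> / 16 \<le> ln (\<delta> / 8)"
    using assms by (simp add: field_simps ln_div)
  then show ?thesis using assms by (simp add: ln_ge_iff)
qed

lemma nat_ceiling_le: "0 \<le> x \<Longrightarrow> real (nat \<lceil>x\<rceil>) \<le> x + 1"
  by linarith

text \<open>Keeps both logarithms of the bound away from 0, so that additive constants and the sum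
  of the two are absorbed into their product.\<close>

lemma ln_inverse_ge: "0 < x \<Longrightarrow> x \<le> 1/2 \<Longrightarrow> 2/3 \<le> ln (1 / x :: real)"
proof -
  assume "0 < x" "x \<le> 1/2"
  then have "ln 2 \<le> ln (1 / x)" by (intro ln_mono) (auto simp: field_simps)
  then show "2/3 \<le> ln (1 / x)" using ln2_ge_two_thirds by simp
qed

lemma sample_bound:
  fixes \<eta> \<epsilon> \<delta> :: real
  assumes eta: "0 < \<eta>" "\<eta> \<le> 1/2" and eps: "0 < \<epsilon>" "\<epsilon> \<le> 1/2" and delta: "0 < \<delta>" "\<delta> \<le> 1/2"
  defines "M \<equiv> num_arms \<eta> \<delta>"
  shows "M * real (num_samples \<epsilon> (\<eta> / 8)) + num_samples \<epsilon> (\<delta> / (8 * real M)) * (16 / \<eta> + M * (\<delta> / 8))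
     \<le> 12000 * ln (1 / \<delta>) * ln (1 / \<eta>) / (\<eta> * \<epsilon>\<^sup>2)"
proof -
  define l where "l = ln (1 / \<delta>)"
  define e where "e = ln (1 / \<eta>)"
  define L where "L = real (num_samples \<epsilon> (\<eta> / 8))"
  define K where "K = real (num_samples \<epsilon> (\<delta> / (8 * real M)))"
  have l: "2/3 \<le> l" and e: "2/3 \<le> e"
    unfolding l_def e_def using ln_inverse_ge eta delta by auto
  have ln8: "ln 8 = 3 * ln (2::real)"
    using ln_realpow[of 2 3] by simp
  have ln8_le: "ln 8 \<le> (25/12 :: real)" using ln8 ln2_le_25_over_36 by simp
  have ln8_l: "ln (8 / \<delta>) \<le> 5 * l"
  proof -
    have "ln (8 / \<delta>) = ln 8 + l" unfolding l_def using delta by (simp add: ln_div)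
    then show ?thesis using ln8_le l by simp
  qed
  have ln8_e: "ln (1 / (\<eta> / 8)) \<le> 5 * e"
  proof -
    have "ln (1 / (\<eta> / 8)) = ln 8 + e" unfolding e_def using eta by (simp add: ln_div)
    then show ?thesis using ln8_le e by simp
  qed
  have M_pos: "0 < M"
    unfolding M_def num_arms_def using eta delta by simp
  have eps2: "\<epsilon>\<^sup>2 \<le> 1/4" using power_mono[OF eps(2), of 2] eps by (simp add: power2_eq_square)
  have M: "M \<le> 81 * l / \<eta>"
  proof -
    have "M \<le> 16 / \<eta> * ln (8 / \<delta>) + 1"
      unfolding M_def num_arms_def using eta delta by (intro nat_ceiling_le) simp
    also have "\<dots> \<le> 16 / \<eta> * (5 * l) + l / \<eta>"
    proof (intro add_mono mult_left_mono ln8_l)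
      \<comment> \<open>The 1 from rounding up costs one more multiple: 81 = 16 * 5 + 1, and below
        41 = 8 * 5 + 1.\<close>
      show "1 \<le> l / \<eta>" using eta l by (simp add: field_simps)
    qed (use eta in auto)
    finally show ?thesis by (simp add: field_simps)
  qed
  have L: "L \<le> 41 * e / \<epsilon>\<^sup>2"
  proof -
    have "L \<le> 8 / \<epsilon>\<^sup>2 * ln (1 / (\<eta> / 8)) + 1"
      unfolding L_def num_samples_def using eta by (intro nat_ceiling_le) simp
    also have "\<dots> \<le> 8 / \<epsilon>\<^sup>2 * (5 * e) + e / \<epsilon>\<^sup>2"
    proof (intro add_mono mult_left_mono ln8_e)
      show "1 \<le> e / \<epsilon>\<^sup>2" using eps eps2 e by (simp add: field_simps)
    qed auto
    finally show ?thesis by (simp add: field_simps)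
  qed
  have l_le: "l \<le> 1 / \<delta>"
    unfolding l_def using ln_le_minus_one[of "1 / \<delta>"] delta by simp
  have lnM: "ln (1 / (\<delta> / (8 * real M))) \<le> 13 * l + e"
  proof -
    \<comment> \<open>81 is rounded up to a power of two so that its logarithm is a multiple of ln
      2.\<close>
    have "ln (real M) \<le> ln (2 ^ 7 / (\<delta> * \<eta>))"
    proof -
      have "M \<le> 81 * l / \<eta>" by (rule M)
      also have "\<dots> \<le> 81 * (1 / \<delta>) / \<eta>"
        using l_le eta by (intro divide_right_mono mult_left_mono) auto
      also have "\<dots> \<le> 2 ^ 7 / (\<delta> * \<eta>)" using eta delta by (simp add: field_simps)
      finally show ?thesis using M_pos by (intro ln_mono) auto
    qed
    also have "\<dots> = 7 * ln 2 + l + e"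
      unfolding l_def e_def using eta delta ln_realpow[of 2 7] by (simp add: ln_div ln_mult)
    finally have "ln (real M) \<le> 7 * ln 2 + l + e" .
    moreover have "ln (1 / (\<delta> / (8 * real M))) = ln 8 + ln (real M) + l"
      unfolding l_def using delta M_pos by (simp add: ln_div ln_mult)
    \<comment> \<open>The constants ln 8 and 7 ln 2 add up to 10 ln 2 \<le> 11 l; two more l give 13
      l.\<close>
    ultimately show ?thesis using ln8 ln2_le_25_over_36 l by simp
  qed
  have K: "K \<le> 106 * (l + e) / \<epsilon>\<^sup>2"
  proof -
    have "\<delta> / (8 * real M) \<le> 1"
    proof -
      have "\<delta> \<le> 8 * real M" using delta M_pos by simp
      then show ?thesis using M_pos by simp
    qed
    then have "0 \<le> ln (1 / (\<delta> / (8 * real M)))"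
      using delta M_pos by (intro ln_ge_zero) simp
    then have "K \<le> 8 / \<epsilon>\<^sup>2 * ln (1 / (\<delta> / (8 * real M))) + 1"
      unfolding K_def num_samples_def by (intro nat_ceiling_le) simp
    also have "\<dots> \<le> 8 / \<epsilon>\<^sup>2 * (13 * l + e) + l / \<epsilon>\<^sup>2"
    proof (intro add_mono mult_left_mono lnM)
      show "1 \<le> l / \<epsilon>\<^sup>2" using eps eps2 l by (simp add: field_simps)
    qed auto
    also have "\<dots> = (105 * l + 8 * e) / \<epsilon>\<^sup>2" by (simp add: algebra_simps add_divide_distrib)
    also have "\<dots> \<le> 106 * (l + e) / \<epsilon>\<^sup>2"
      using l e by (intro divide_right_mono) auto
    finally show ?thesis .
  qed
  \<comment> \<open>By l \<le> 1/\<delta> the logarithm in M cancels against \<delta>, leaving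
    O(1/\<eta>).\<close>
  have "M * (\<delta> / 8) \<le> 81 * l / \<eta> * (\<delta> / 8)"
    using M delta by (intro mult_right_mono) auto
  also have "\<dots> \<le> 81 * (1 / \<delta>) / \<eta> * (\<delta> / 8)"
    using l_le eta delta by (intro mult_right_mono divide_right_mono mult_left_mono) auto
  also have "\<dots> \<le> 11 / \<eta>" using eta delta by (simp add: field_simps)
  finally have T: "16 / \<eta> + M * (\<delta> / 8) \<le> 27 / \<eta>" by simp
  have "K * (16 / \<eta> + M * (\<delta> / 8)) \<le> 106 * (l + e) / \<epsilon>\<^sup>2 * (27 / \<eta>)"
    using K T eta delta l e by (intro mult_mono) (auto simp: K_def)
  also have "\<dots> = 2862 * (l + e) / (\<eta> * \<epsilon>\<^sup>2)" by simp
  also have "\<dots> \<le> 2862 * (3/2 * l * e + 3/2 * l * e) / (\<eta> * \<epsilon>\<^sup>2)"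
  proof -
    \<comment> \<open>Each logarithm is at least 2/3, so the sum l + e is at most 3 l e.\<close>
    have "l \<le> 3/2 * l * e" "e \<le> 3/2 * l * e"
      using mult_left_mono[OF e, of l] mult_right_mono[OF l, of e] l e by auto
    then show ?thesis using eta by (intro divide_right_mono mult_left_mono add_mono) auto
  qed
  finally have 2: "K * (16 / \<eta> + M * (\<delta> / 8)) \<le> 8586 * l * e / (\<eta> * \<epsilon>\<^sup>2)"
    by (simp add: mult.commute mult.left_commute)
  have "M * L \<le> 81 * l / \<eta> * (41 * e / \<epsilon>\<^sup>2)"
    using M L eta l by (intro mult_mono) (auto simp: L_def)
  then have 1: "M * L \<le> 3321 * l * e / (\<eta> * \<epsilon>\<^sup>2)" by simp
  \<comment> \<open>11907 = 81 * 41 + 3 * 106 * 27.\<close>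
  have "M * L + K * (16 / \<eta> + M * (\<delta> / 8)) \<le> 11907 * l * e / (\<eta> * \<epsilon>\<^sup>2)"
    using add_mono[OF 1 2] by (simp add: add_divide_distrib[symmetric] mult.commute mult.left_commute)
  also have "\<dots> \<le> 12000 * l * e / (\<eta> * \<epsilon>\<^sup>2)"
    using eta l e by (intro divide_right_mono mult_right_mono) auto
  finally show ?thesis unfolding L_def K_def l_def e_def .
qed

theorem theorem1p1:
  shows "\<exists>C>0. \<forall>\<eta> \<epsilon> \<delta>::real.
     \<eta> \<in> {0<..1/2} \<and> \<epsilon> \<in> {0<..1/2} \<and> \<delta> \<in> {0<..1/2} \<longrightarrow>
     (\<exists>A. bandit_alg A \<and>
        (\<forall>mu. reservoir mu \<longrightarrow>
           measure (bandit_space mu) (success_event A mu \<eta> \<epsilon>) \<ge> 1 - \<delta> \<and>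
           expected_samples A mu \<le> ennreal (C * ln (1/\<delta>) * ln (1/\<eta>) / (\<eta> * \<epsilon>^2))))"
proof (intro exI[of _ "12000::real"] conjI allI impI)
  fix \<eta> \<epsilon> \<delta> :: real
  assume *: "\<eta> \<in> {0<..1/2} \<and> \<epsilon> \<in> {0<..1/2} \<and> \<delta> \<in> {0<..1/2}"
  define M where "M = num_arms \<eta> \<delta>"
  define L where "L = num_samples \<epsilon> (\<eta> / 8)"
  define K where "K = num_samples \<epsilon> (\<delta> / (8 * real M))"
  have M_pos: "0 < M" using * by (simp add: M_def num_arms_def)
  then have M_ge: "1 \<le> real M" by simp
  have small: "\<delta> / (8 * real M) \<le> 1 / 8" using * M_ge by (simp add: field_simps)
  \<comment> \<open>\<open>M\<close>, \<open>L\<close> and \<open>K\<close> are fixed before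
    \<open>mu\<close>, so one algorithm serves every reservoir.\<close>
  have Q: "quantile_bandit mu M L K \<eta> \<epsilon> \<delta>" if "reservoir mu" for mu
  proof
    show "0 < L" "0 < K"
      unfolding L_def K_def using * small M_pos by (auto intro!: num_samples_pos)
    show "exp (- \<eta> * M / 16) \<le> \<delta> / 8"
      unfolding M_def using * by (intro exp_num_arms_le) auto
    show "exp (- 2 * real L * (\<epsilon> / 4)\<^sup>2) \<le> \<eta> / 8"
      unfolding L_def using * by (intro exp_num_samples_le) auto
    show K: "exp (- 2 * real K * (\<epsilon> / 4)\<^sup>2) \<le> \<delta> / (8 * real M)"
      unfolding K_def using * M_pos by (intro exp_num_samples_le) auto
    show "exp (- 2 * real K * (\<epsilon> / 4)\<^sup>2) \<le> 1 / 8"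
      by (rule order_trans[OF K small])
  qed (use * that M_pos in auto)
  have "ennreal (M * real L + K * (16 / \<eta> + M * (\<delta> / 8))) \<le> ennreal (12000 * ln (1/\<delta>) * ln (1/\<eta>) / (\<eta> * \<epsilon>^2))"
    using sample_bound[of \<eta> \<epsilon> \<delta>] * unfolding M_def L_def K_def by (intro ennreal_leI) auto
  then show "\<exists>A. bandit_alg A \<and>
        (\<forall>mu. reservoir mu \<longrightarrow>
           measure (bandit_space mu) (success_event A mu \<eta> \<epsilon>) \<ge> 1 - \<delta> \<and>
           expected_samples A mu \<le> ennreal (12000 * ln (1/\<delta>) * ln (1/\<eta>) / (\<eta> * \<epsilon>^2)))"
    using quantile_bandit.prob_success[OF Q] order_trans[OF quantile_bandit.expected_samples_bound[OF Q]]
    by (intro exI[of _ "quantile_alg M L K \<eta> \<epsilon>"]) (auto simp: quantile_alg_def bandit_alg_sweep)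
qed simp

end
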